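(* Let $N\ge0$ be an integer and consider the POMDP and the finite-window Q-learning iteration $(Q_t)$ run under an exploration policy $\gamma$, as defined in the context. Assume: - The learning rates satisfy $\alpha_t(I,u)=0$ unless $(I_t,U_t)=(I,u)$, and in that case $\alpha_t(I,u)=\dfrac{1}{1+\sum_{k=0}^{t}\mathbf 1_{\{I_k=I,\,U_k=u\}}}$; under every stationary (memoryless or finite-memory exploration) policy the state process $\{X_t\}$ is positive Harris recurrent and in particular admits a unique invariant probability measure; and during exploration every pair $(I,u)$ is visited infinitely often. - The state space $\mathbb X$ is finite. - Under the exploration policy $\gamma$, the state process $\{X_t\}$ is irreducible. - $\alpha:=(1-\tilde\delta(\mathcal T))(2-\delta(O))<1$, where $\delta$ is the Dobrushin coefficient and $\tilde\delta(\mathcal T)=\inf_{u\in\mathbb U}\delta(\mathcal T(\cdot|\cdot,u))$. Let $Q^*$ be the function defined in the context through the invariant measure $\pi^*$ of $\{X_t\}$ under $\gamma$ (the almost sure limit of $Q_t$). Then, for any policy $\gamma^N:\mathbb Y^{N+1}\times\mathbb U^N\to\mathbb U$ that satisfies $Q^*(I,\gamma^N(I))=\min_uQ^*(I,u)$ for all $I$, if the controller starts using $\gamma^N$ at time $t=N$ (after observing at least $N$ information variables), then, denoting the prior distribution of $X_N$ by $\pi_N^-$, conditioned on the first $N$ step information variables $I_0^N=(Y_{[0,N]},U_{[0,N-1]})$ we have $$E\big[J_\beta(\pi_N^-,\mathcal T,\gamma^N)-J^*_\beta(\pi_N^-,\mathcal T)\ \big|\ I_0^N\big]\le\frac{4\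|c\|_\infty}{(1-\beta)^2}\,\alpha^N.$$
   Context: POMDP: $\mathbb X$ is the state space, $\mathbb Y$ and $\mathbb U$ are finite sets (observations, actions), $\mathcal T(dx'|x,u)$ is a stochastic kernel from $\mathbb X\times\mathbb U$ to $\mathbb X$, $O(y|x)$ a stochastic kernel from $\mathbb X$ to $\mathbb Y$, $c:\mathbb X\times\mathbb U\to\mathbb R$ is bounded measurable, $\beta\in(0,1)$. Dynamics: $X_{t+1}\sim\mathcal T(\cdot|X_t,U_t)$, $Y_t\sim O(\cdot|X_t)$; the controller sees only observations and past actions (and, in learning, the realized costs). Dobrushin coefficient of a stochastic kernel $K$ from $S_1$ to $S_2$: $\delta(K)=\inf\sum_{i=1}^n\min(K(x,A_i),K(y,A_i))$, the infimum being over all $x,y\in S_1$ and all finite measurable partitions $\{A_i\}_{i=1}^n$ of $S_2$. Conditional laws: for a probability $\pi$ on $\mathbb X$, $P^{\pi}$ denotes conditional laws when the state at the beginning of the window has prior $\pi$. Explicitly, let $B(\pi,y)(A)=\int_A O(y|x)\pi(dx)/\int O(y|x)\pi(dx)$ (equal to an arbitrary fixed probability measure if the denominator is $0$). Then $P^\pi(X_0\in\cdot|y_0)=B(\pi,y_0)$; $P^\pi(X_{k+1}\in\cdot|y_{[0,k+1]},u_{[0,k]})=B\big(\int\mathcal T(\cdot|x,u_k)P^\pi(dx|y_{[0,k]},u_{[0,k-1]}),\,y_{k+1}\big)$; and $P^\pi(y_{k+1}|y_{[0,k]},u_{[0,k]})=\int\int O(y_{k+1}|x')\mathcal T(dx'|x,u_k)P^\pi(dx|y_{[0,k]},u_{[0,k-1]})$.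 The prior $\pi_N^-$ of $X_N$ is the predictor, i.e. the conditional law of $X_N$ given $Y_{[0,N-1]},U_{[0,N-1]}$. Q-learning: the exploration policy $\gamma$ chooses actions $U_t$ i.i.d., independently of everything else, with $\Pr(U_t=u_i)=\sigma_i>0$ for every $u_i\in\mathbb U$. For $t\ge N$ let $I_t=(Y_{[t-N,t]},U_{[t-N,t-1]})\in\mathbb Y^{N+1}\times\mathbb U^N$; times before a full window is available are not counted as visits. From an arbitrary initial function, $Q_{t+1}(I,u)=(1-\alpha_t(I,u))Q_t(I,u)+\alpha_t(I,u)\big(C_t(I,u)+\beta\min_{v}Q_t(I_{t+1},v)\big)$, where, when $(I_t,U_t)=(I,u)$, $C_t(I,u)=c(X_t,U_t)$. $Q^*$ is the unique solution of $Q^*(I,u)=C^*(I,u)+\beta\sum_{I'}P^*(I'|I,u)\min_vQ^*(I',v)$ where, for $I=(y_{[0,N]},u_{[0,N-1]})$ and $u=u_N$, $C^*(I,u)=\int c(x,u)P^{\pi^*}(X_N\in dx|y_{[0,N]},u_{[0,N-1]})$, and $P^*(\cdot|I,u)$ gives mass $P^{\pi^*}(y_{N+1}|y_{[0,N]},u_{[0,N]})$ to $I'=(y_{[1,N+1]},u_{[1,N]})$ for each $y_{N+1}\in\mathbb Y$, and mass $0$ to all other $I'$. Costs: $J_\beta(\mu,\mathcal T,\gamma')=E_\mu^{\mathcal T,\gamma'}\big[\sum_{t\ge0}\beta^tc(X_t,U_t)\big]$ is the discounted cost of a policy $\gamma'$ when the initial state has distribution $\mu$, and $J^*_\beta(\mu,\mathcal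 T)=\inf_{\gamma'}J_\beta(\mu,\mathcal T,\gamma')$ over admissible policies (actions being measurable functions of the available observations and past actions). In the conclusion these are used with time $N$ as the time at which the cost starts running, i.e. the criterion is $E\big[\sum_{k\ge N}\beta^{k-N}c(X_k,U_k)\big]$, with $X_N$ having prior $\pi_N^-$, and $\gamma^N$ acts by $U_k=\gamma^N(Y_{[k-N,k]},U_{[k-N,k-1]})$ for $k\ge N$.
   Formalization: The bound is proved for the mean of J_β(π_N^-,T,γ^N) − J*_β(π_N^-,T) over the realizations of I_0^N, for every initial law and every policy used before time N; the bound conditional on each single realization of I_0^N fails in general. *)

theory Defs
  imports "HOL-Probability.Probability"
begin

section \<open>Stochastic kernels\<close>

text \<open>State, observation and action spaces are finite types, so a stochastic kernel is a
  \<open>pmf\<close>-valued function: \<open>T x u = \<T>(\<cdot>|x,u)\<close> and \<open>Ob x = O(\<cdot>|x)\<close>.\<close>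

definition dobrushin :: "('a \<Rightarrow> 'b pmf) \<Rightarrow> real" where
  "dobrushin K = Inf {(\<Sum>A\<in>P. min (measure_pmf.prob (K x) A) (measure_pmf.prob (K y) A)) |x y P.
     finite P \<and> partition_on UNIV P}"

definition dobrushin_tilde :: "('x \<Rightarrow> 'u \<Rightarrow> 'x pmf) \<Rightarrow> real" where
  "dobrushin_tilde T = (INF u. dobrushin (\<lambda>x. T x u))"

definition supnorm :: "('x \<Rightarrow> 'u \<Rightarrow> real) \<Rightarrow> real" where
  "supnorm c = (SUP (x, u). \<bar>c x u\<bar>)"


section \<open>Conditional laws\<close>

text \<open>The parameter \<open>\<rho>\<close> is the arbitrary value used when the observation has probability zero.\<close>

definition bayes ::
  "'x pmf \<Rightarrow> ('x \<Rightarrow> 'y pmf) \<Rightarrow> 'x pmf \<Rightarrow> 'y \<Rightarrow> 'x pmf" where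
  "bayes \<rho> Ob p y =
     (let Z = measure_pmf.expectation p (\<lambda>x. pmf (Ob x) y)
      in if Z = 0 then \<rho> else embed_pmf (\<lambda>x. pmf (Ob x) y * pmf p x / Z))"

lemma pmf_bayes:
  fixes p :: "'x::finite pmf" and Ob :: "'x \<Rightarrow> 'y pmf"
  defines "Z \<equiv> \<lambda>y. measure_pmf.expectation p (\<lambda>x. pmf (Ob x) y)"
  assumes "Z y \<noteq> 0"
  shows "pmf (bayes \<rho> Ob p y) x = pmf (Ob x) y * pmf p x / Z y"
proof -
  have Z: "Z y = (\<Sum>x\<in>UNIV. pmf (Ob x) y * pmf p x)"
    unfolding Z_def by (subst integral_measure_pmf[of UNIV]) (auto simp: mult.commute)
  have Z_eq: "measure_pmf.expectation p (\<lambda>x. pmf (Ob x) y) = Z y"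
    by (simp add: Z_def)
  have Z0: "Z y \<ge> 0"
    unfolding Z by (intro sum_nonneg) auto
  have "(\<Sum>x\<in>UNIV. pmf (Ob x) y * pmf p x / Z y) = 1"
    using assms(2) by (simp add: sum_divide_distrib[symmetric] Z[symmetric])
  then have "(\<integral>\<^sup>+x. ennreal (pmf (Ob x) y * pmf p x / Z y) \<partial>count_space UNIV) = 1"
    using Z0 by (subst nn_integral_count_space_finite) (auto simp: sum_ennreal)
  then show ?thesis
    using assms(2) Z0 by (simp add: bayes_def Let_def pmf_embed_pmf Z_eq)
qed

text \<open>Here and below \<open>y\<close> and \<open>u\<close> are sequences of which only finitely many entries are used:
  \<open>posterior \<rho> T Ob p y u k\<close> is \<open>P\<^sup>p(X\<^sub>k \<in> \<cdot> | y\<^bsub>[0,k]\<^esub>, u\<^bsub>[0,k-1]\<^esub>)\<close>, and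
  \<open>predictor \<rho> T Ob p y u k\<close> is \<open>P\<^sup>p(X\<^sub>k \<in> \<cdot> | y\<^bsub>[0,k-1]\<^esub>, u\<^bsub>[0,k-1]\<^esub>)\<close>.\<close>

primrec posterior ::
  "'x pmf \<Rightarrow> ('x \<Rightarrow> 'u \<Rightarrow> 'x pmf) \<Rightarrow> ('x \<Rightarrow> 'y pmf) \<Rightarrow> 'x pmf
     \<Rightarrow> (nat \<Rightarrow> 'y) \<Rightarrow> (nat \<Rightarrow> 'u) \<Rightarrow> nat \<Rightarrow> 'x pmf" where
  "posterior \<rho> T Ob p y u 0 = bayes \<rho> Ob p (y 0)"
| "posterior \<rho> T Ob p y u (Suc k) =
     bayes \<rho> Ob (bind_pmf (posterior \<rho> T Ob p y u k) (\<lambda>x. T x (u k))) (y (Suc k))"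

definition predictor ::
  "'x pmf \<Rightarrow> ('x \<Rightarrow> 'u \<Rightarrow> 'x pmf) \<Rightarrow> ('x \<Rightarrow> 'y pmf) \<Rightarrow> 'x pmf
     \<Rightarrow> (nat \<Rightarrow> 'y) \<Rightarrow> (nat \<Rightarrow> 'u) \<Rightarrow> nat \<Rightarrow> 'x pmf" where
  "predictor \<rho> T Ob p y u k = (case k of 0 \<Rightarrow> p
     | Suc j \<Rightarrow> bind_pmf (posterior \<rho> T Ob p y u j) (\<lambda>x. T x (u j)))"

definition next_obs ::
  "'x pmf \<Rightarrow> ('x \<Rightarrow> 'u \<Rightarrow> 'x pmf) \<Rightarrow> ('x \<Rightarrow> 'y pmf) \<Rightarrow> 'x pmf
     \<Rightarrow> (nat \<Rightarrow> 'y) \<Rightarrow> (nat \<Rightarrow> 'u) \<Rightarrow> nat \<Rightarrow> 'y pmf" where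
  "next_obs \<rho> T Ob p y u k = bind_pmf (predictor \<rho> T Ob p y u (Suc k)) Ob"


section \<open>Windows and the limiting fixed-point equation\<close>

text \<open>A window \<open>(y\<^bsub>[0,N]\<^esub>, u\<^bsub>[0,N-1]\<^esub>)\<close> is a pair of lists in chronological order.\<close>

type_synonym ('y, 'u) window = "'y list \<times> 'u list"

definition windows :: "nat \<Rightarrow> ('y, 'u) window set" where
  "windows N = {(ys, us). length ys = N + 1 \<and> length us = N}"

fun shift_window :: "('y, 'u) window \<Rightarrow> 'u \<Rightarrow> 'y \<Rightarrow> ('y, 'u) window" where
  "shift_window (ys, us) u y = (tl (ys @ [y]), tl (us @ [u]))"

definition Cstar ::
  "'x pmf \<Rightarrow> ('x \<Rightarrow> 'u \<Rightarrow> 'x pmf) \<Rightarrow> ('x \<Rightarrow> 'y pmf) \<Rightarrow> ('x \<Rightarrow> 'u \<Rightarrow> real) \<Rightarrow> nat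
     \<Rightarrow> 'x pmf \<Rightarrow> ('y, 'u) window \<Rightarrow> 'u \<Rightarrow> real" where
  "Cstar \<rho> T Ob c N p = (\<lambda>(ys, us) u.
     measure_pmf.expectation (posterior \<rho> T Ob p ((!) ys) ((!) us) N) (\<lambda>x. c x u))"

definition Pstar ::
  "'x pmf \<Rightarrow> ('x \<Rightarrow> 'u \<Rightarrow> 'x pmf) \<Rightarrow> ('x \<Rightarrow> 'y pmf) \<Rightarrow> nat
     \<Rightarrow> 'x pmf \<Rightarrow> ('y, 'u) window \<Rightarrow> 'u \<Rightarrow> ('y, 'u) window pmf" where
  "Pstar \<rho> T Ob N p = (\<lambda>(ys, us) u.
     map_pmf (shift_window (ys, us) u) (next_obs \<rho> T Ob p ((!) ys) ((!) (us @ [u])) N))"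

definition solves_Qstar ::
  "'x pmf \<Rightarrow> ('x \<Rightarrow> 'u \<Rightarrow> 'x pmf) \<Rightarrow> ('x \<Rightarrow> 'y pmf) \<Rightarrow> ('x \<Rightarrow> 'u \<Rightarrow> real) \<Rightarrow> real \<Rightarrow> nat
     \<Rightarrow> 'x pmf \<Rightarrow> (('y, 'u) window \<Rightarrow> 'u \<Rightarrow> real) \<Rightarrow> bool" where
  "solves_Qstar \<rho> T Ob c \<beta> N p Q \<longleftrightarrow> (\<forall>I\<in>windows N. \<forall>u.
     Q I u = Cstar \<rho> T Ob c N p I u
       + \<beta> * (\<Sum>I'\<in>windows N. pmf (Pstar \<rho> T Ob N p I u) I' * Min (range (Q I'))))"


section \<open>Controlled trajectories\<close>

text \<open>A (randomized, history-dependent) admissible policy \<open>g\<close> draws \<open>U\<^sub>t\<close> from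
  \<open>g Y\<^bsub>[0,t]\<^esub> U\<^bsub>[0,t-1]\<^esub>\<close>. A trajectory is a sequence of triples \<open>(X\<^sub>t, Y\<^sub>t, U\<^sub>t)\<close>.\<close>

type_synonym ('y, 'u) policy = "'y list \<Rightarrow> 'u list \<Rightarrow> 'u pmf"

abbreviation st :: "'x \<times> 'y \<times> 'u \<Rightarrow> 'x" where "st z \<equiv> fst z"
abbreviation ob :: "'x \<times> 'y \<times> 'u \<Rightarrow> 'y" where "ob z \<equiv> fst (snd z)"
abbreviation ac :: "'x \<times> 'y \<times> 'u \<Rightarrow> 'u" where "ac z \<equiv> snd (snd z)"

definition step_pmf ::
  "('x \<Rightarrow> 'u \<Rightarrow> 'x pmf) \<Rightarrow> ('x \<Rightarrow> 'y pmf) \<Rightarrow> 'x pmf \<Rightarrow> ('y, 'u) policy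
     \<Rightarrow> nat \<Rightarrow> (nat \<Rightarrow> 'x \<times> 'y \<times> 'u) \<Rightarrow> ('x \<times> 'y \<times> 'u) pmf" where
  "step_pmf T Ob \<mu> g t \<omega> =
     bind_pmf (case t of 0 \<Rightarrow> \<mu> | Suc s \<Rightarrow> T (st (\<omega> s)) (ac (\<omega> s))) (\<lambda>x.
     bind_pmf (Ob x) (\<lambda>y.
     bind_pmf (g (map (\<lambda>k. ob (\<omega> k)) [0..<t] @ [y]) (map (\<lambda>k. ac (\<omega> k)) [0..<t])) (\<lambda>u.
     return_pmf (x, y, u))))"

text \<open>The law of the whole trajectory, obtained from the one-step conditional laws by the
  Ionescu-Tulcea theorem.\<close>

definition traj ::
  "('x \<Rightarrow> 'u \<Rightarrow> 'x pmf) \<Rightarrow> ('x \<Rightarrow> 'y pmf) \<Rightarrow> 'x pmf \<Rightarrow> ('y, 'u) policy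
     \<Rightarrow> (nat \<Rightarrow> 'x \<times> 'y \<times> 'u) measure" where
  "traj T Ob \<mu> g = projective_family.lim UNIV
     (Ionescu_Tulcea.CI (\<lambda>t \<omega>. measure_pmf (step_pmf T Ob \<mu> g t \<omega>)) (\<lambda>_. count_space UNIV))
     (\<lambda>_. count_space UNIV)"

lemma Ionescu_Tulcea_step_pmf:
  fixes T :: "'x::finite \<Rightarrow> 'u::finite \<Rightarrow> 'x pmf" and Ob :: "'x \<Rightarrow> 'y::finite pmf"
  shows "Ionescu_Tulcea (\<lambda>t \<omega>. measure_pmf (step_pmf T Ob \<mu> g t \<omega>)) (\<lambda>_. count_space UNIV)"
proof (rule Ionescu_Tulcea.intro, goal_cases)
  case (1 t)
  have eq: "PiM {0..<t} (\<lambda>_. count_space (UNIV :: ('x \<times> 'y \<times> 'u) set))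
      = count_space (PiE {0..<t} (\<lambda>_. UNIV))"
    by (rule count_space_PiM_finite) auto
  show ?case
    unfolding eq by (auto simp: space_subprob_algebra intro: measure_pmf.subprob_space_axioms)
next
  case (2 t \<omega>)
  show ?case
    by (rule measure_pmf.prob_space_axioms)
qed

text \<open>The window \<open>I\<^sub>t = (Y\<^bsub>[t-N,t]\<^esub>, U\<^bsub>[t-N,t-1]\<^esub>)\<close>, meaningful for \<open>t \<ge> N\<close>.\<close>

definition info :: "nat \<Rightarrow> (nat \<Rightarrow> 'x \<times> 'y \<times> 'u) \<Rightarrow> nat \<Rightarrow> ('y, 'u) window" where
  "info N \<omega> t = (map (\<lambda>k. ob (\<omega> k)) [t - N..<Suc t], map (\<lambda>k. ac (\<omega> k)) [t - N..<t])"

definition discounted_cost ::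
  "('x \<Rightarrow> 'u \<Rightarrow> 'x pmf) \<Rightarrow> ('x \<Rightarrow> 'y pmf) \<Rightarrow> ('x \<Rightarrow> 'u \<Rightarrow> real) \<Rightarrow> real
     \<Rightarrow> 'x pmf \<Rightarrow> ('y, 'u) policy \<Rightarrow> real" where
  "discounted_cost T Ob c \<beta> \<mu> g =
     (\<integral>\<omega>. (\<Sum>t. \<beta> ^ t * c (st (\<omega> t)) (ac (\<omega> t))) \<partial>traj T Ob \<mu> g)"

definition optimal_cost ::
  "('x \<Rightarrow> 'u \<Rightarrow> 'x pmf) \<Rightarrow> ('x \<Rightarrow> 'y pmf) \<Rightarrow> ('x \<Rightarrow> 'u \<Rightarrow> real) \<Rightarrow> real
     \<Rightarrow> 'x pmf \<Rightarrow> real" where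
  "optimal_cost T Ob c \<beta> \<mu> =
     (INF f :: 'y list \<Rightarrow> 'u list \<Rightarrow> 'u. discounted_cost T Ob c \<beta> \<mu> (\<lambda>ys us. return_pmf (f ys us)))"


section \<open>Stationary exploration policies\<close>

definition suffix_of :: "nat \<Rightarrow> 'a list \<Rightarrow> 'a list" where
  "suffix_of n xs = drop (length xs - n) xs"

text \<open>The policy with memory \<open>m\<close> given by \<open>h\<close> (memoryless for \<open>m = 0\<close>); before time \<open>m\<close> the
  window is the shorter list of everything available.\<close>

definition finite_memory :: "nat \<Rightarrow> ('y, 'u) policy \<Rightarrow> ('y, 'u) policy" where
  "finite_memory m h = (\<lambda>ys us. h (suffix_of (m + 1) ys) (suffix_of m us))"

definition exploring :: "('y, 'u) policy \<Rightarrow> bool" where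
  "exploring h \<longleftrightarrow> (\<forall>ys us u. pmf (h ys us) u > 0)"

text \<open>Under a finite-memory policy the state process need not be Markov; the pair of state and
  window is. A law on the state space is called invariant if it is the state marginal of an
  invariant law of that pair. For a policy that draws actions i.i.d. this is invariance under
  the averaged transition kernel of the state.\<close>

definition invariant_law ::
  "('x \<Rightarrow> 'u \<Rightarrow> 'x pmf) \<Rightarrow> ('x \<Rightarrow> 'y pmf) \<Rightarrow> nat \<Rightarrow> ('y, 'u) policy \<Rightarrow> 'x pmf \<Rightarrow> bool" where
  "invariant_law T Ob m h p \<longleftrightarrow> (\<exists>q :: ('x \<times> ('y, 'u) window) pmf.
     set_pmf q \<subseteq> UNIV \<times> windows m \<and> map_pmf fst q = p \<and>
     bind_pmf q (\<lambda>(x, ys, us).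
       bind_pmf (h ys us) (\<lambda>u. bind_pmf (T x u) (\<lambda>x'. bind_pmf (Ob x') (\<lambda>y'.
         return_pmf (x', shift_window (ys, us) u y'))))) = q)"

text \<open>Positive Harris recurrence: every set charged by some reference measure \<open>\<phi>\<close>
  (normalized here to a probability) is visited infinitely often, almost surely and from every
  initial state, and there is a unique invariant probability law.\<close>

definition positive_Harris ::
  "('x \<Rightarrow> 'u \<Rightarrow> 'x pmf) \<Rightarrow> ('x \<Rightarrow> 'y pmf) \<Rightarrow> nat \<Rightarrow> ('y, 'u) policy \<Rightarrow> bool" where
  "positive_Harris T Ob m h \<longleftrightarrow>
     (\<exists>\<phi> :: 'x pmf. \<forall>A. measure_pmf.prob \<phi> A > 0 \<longrightarrow>
        (\<forall>x. AE \<omega> in traj T Ob (return_pmf x) (finite_memory m h). \<exists>\<^sub>\<infinity>t. st (\<omega> t) \<in> A)) \<and>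
     (\<exists>!p. invariant_law T Ob m h p)"

text \<open>Transition kernel of the state process when actions are drawn i.i.d. from \<open>\<sigma>\<close>.\<close>

definition iid_kernel :: "('x \<Rightarrow> 'u \<Rightarrow> 'x pmf) \<Rightarrow> 'u pmf \<Rightarrow> 'x \<Rightarrow> 'x pmf" where
  "iid_kernel T \<sigma> x = bind_pmf \<sigma> (T x)"

definition irreducible_kernel :: "('x \<Rightarrow> 'x pmf) \<Rightarrow> bool" where
  "irreducible_kernel K \<longleftrightarrow>
     (\<forall>x x'. \<exists>n. pmf (((\<lambda>p. bind_pmf p K) ^^ n) (return_pmf x)) x' > 0)"


section \<open>Regret of a window policy started at time N\<close>

text \<open>Policy for the problem restarted at time \<open>N\<close>, when \<open>Y\<^bsub>[0,N-1]\<^esub> = ys\<close> and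
  \<open>U\<^bsub>[0,N-1]\<^esub> = us\<close> were recorded before: \<open>ys'\<close> and \<open>us'\<close> are the data from time \<open>N\<close> on.\<close>

definition window_policy ::
  "nat \<Rightarrow> (('y, 'u) window \<Rightarrow> 'u) \<Rightarrow> 'y list \<Rightarrow> 'u list \<Rightarrow> ('y, 'u) policy" where
  "window_policy N \<gamma>N ys us =
     (\<lambda>ys' us'. return_pmf (\<gamma>N (suffix_of (N + 1) (ys @ ys'), suffix_of N (us @ us'))))"

text \<open>The random variable \<open>J\<^sub>\<beta>(\<pi>\<^sub>N\<^sup>-, \<T>, \<gamma>\<^sup>N) - J\<^sup>*\<^sub>\<beta>(\<pi>\<^sub>N\<^sup>-, \<T>)\<close> as a function of \<open>I\<^sub>0\<^sup>N\<close>. The cost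
  starts from \<open>X\<^sub>N\<close> distributed as \<open>\<pi>\<^sub>N\<^sup>-\<close>, so \<open>Y\<^sub>N\<close> is averaged inside both terms and only
  \<open>Y\<^bsub>[0,N-1]\<^esub>, U\<^bsub>[0,N-1]\<^esub>\<close> enter.\<close>

definition regret ::
  "'x pmf \<Rightarrow> ('x \<Rightarrow> 'u \<Rightarrow> 'x pmf) \<Rightarrow> ('x \<Rightarrow> 'y pmf) \<Rightarrow> ('x \<Rightarrow> 'u \<Rightarrow> real) \<Rightarrow> real \<Rightarrow> nat
     \<Rightarrow> (('y, 'u) window \<Rightarrow> 'u) \<Rightarrow> 'x pmf \<Rightarrow> ('y, 'u) window \<Rightarrow> real" where
  "regret \<rho> T Ob c \<beta> N \<gamma>N \<mu> = (\<lambda>(ys, us).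
     let piN = predictor \<rho> T Ob \<mu> ((!) ys) ((!) us) N
     in discounted_cost T Ob c \<beta> piN (window_policy N \<gamma>N (take N ys) us)
        - optimal_cost T Ob c \<beta> piN)"

text \<open>\<open>E[J\<^sub>\<beta>(\<pi>\<^sub>N\<^sup>-, \<T>, \<gamma>\<^sup>N) - J\<^sup>*\<^sub>\<beta>(\<pi>\<^sub>N\<^sup>-, \<T>) | I\<^sub>0\<^sup>N]\<close> is read as the mean over the realizations of
  \<open>I\<^sub>0\<^sup>N\<close>, when \<open>X\<^sub>0\<close> has law \<open>\<mu>\<close> and \<open>g\<close> is used before time \<open>N\<close>. Inside this mean,
  conditioning on \<open>I\<^sub>0\<^sup>N\<close> would change nothing, because \<open>regret\<close> is a function of \<open>I\<^sub>0\<^sup>N\<close>. A bound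
  of order \<open>\<alpha>\<^sup>N\<close> for each single realization is false in general: filter stability is a
  statement in mean, and a rare observation record need not forget the prior.\<close>

definition expected_regret ::
  "'x pmf \<Rightarrow> ('x \<Rightarrow> 'u \<Rightarrow> 'x pmf) \<Rightarrow> ('x \<Rightarrow> 'y pmf) \<Rightarrow> ('x \<Rightarrow> 'u \<Rightarrow> real) \<Rightarrow> real \<Rightarrow> nat
     \<Rightarrow> (('y, 'u) window \<Rightarrow> 'u) \<Rightarrow> 'x pmf \<Rightarrow> ('y, 'u) policy \<Rightarrow> real" where
  "expected_regret \<rho> T Ob c \<beta> N \<gamma>N \<mu> g =
     (\<integral>\<omega>. regret \<rho> T Ob c \<beta> N \<gamma>N \<mu> (info N \<omega> N) \<partial>traj T Ob \<mu> g)"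

end

theory Submission
  imports Defs
begin

text \<open>One Bayes step expands the mean \<open>l\<^sub>1\<close> distance of two filters by at most \<open>2 - \<delta>(O)\<close> and
  one transition contracts it by \<open>1 - \<delta>(\<T>)\<close>. Hence, under every policy, the mean distance between
  the true posterior and the one computed from the last window with prior \<open>\<pi>\<^sup>*\<close> is at most \<open>2 \<alpha>\<^sup>N\<close>.
  Along the true process the value \<open>V(I) = min\<^sub>u Q\<^sup>*(I,u)\<close> therefore satisfies the Bellman inequality
  for every policy, and the Bellman equality for a greedy one, up to a mean error of
  \<open>2 \<alpha>\<^sup>N \<parallel>c\<parallel>\<^sub>\<infinity> / (1 - \<beta>)\<close> per step. Telescoping compares both the cost of \<open>\<gamma>\<^sup>N\<close> and the cost of an
  arbitrary competitor with \<open>E V(I\<^sub>N)\<close>. The competitor may depend on the data before time \<open>N\<close>;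
  it is glued to the initial policy so that the stability estimate covers windows that reach back
  before time \<open>N\<close>.\<close>

section \<open>Total variation and Bayes' rule on finite spaces\<close>

lemma expectation_finite:
  fixes p :: "'a::finite pmf" and f :: "'a \<Rightarrow> real"
  shows "measure_pmf.expectation p f = (\<Sum>x\<in>UNIV. f x * pmf p x)"
  by (rule integral_measure_pmf_real) auto

lemma pmf_bind_finite:
  fixes p :: "'a::finite pmf"
  shows "pmf (bind_pmf p K) y = (\<Sum>x\<in>UNIV. pmf p x * pmf (K x) y)"
  by (simp add: pmf_bind expectation_finite mult.commute)

lemma sum_pmf_UNIV: "(\<Sum>x\<in>UNIV. pmf (p :: 'a::finite pmf) x) = 1"
  by (rule sum_pmf_eq_1) auto

text \<open>Twice the total variation distance, so its range is [0, 2].\<close>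

definition l1_dist :: "'a::finite pmf \<Rightarrow> 'a pmf \<Rightarrow> real" where
  "l1_dist p q = (\<Sum>x\<in>UNIV. \<bar>pmf p x - pmf q x\<bar>)"

lemma l1_dist_nonneg: "0 \<le> l1_dist p q"
  by (simp add: l1_dist_def sum_nonneg)

lemma l1_dist_le_2: "l1_dist p q \<le> 2"
proof -
  have "l1_dist p q \<le> (\<Sum>x\<in>UNIV. pmf p x + pmf q x)"
    unfolding l1_dist_def by (intro sum_mono) (simp add: abs_le_iff)
  then show ?thesis by (simp add: sum.distrib sum_pmf_UNIV)
qed

lemma expectation_diff_le_l1_dist:
  fixes p q :: "'a::finite pmf"
  assumes "\<And>x. \<bar>f x\<bar> \<le> B"
  shows "\<bar>measure_pmf.expectation p f - measure_pmf.expectation q f\<bar> \<le> B * l1_dist p q"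
proof -
  have "\<bar>measure_pmf.expectation p f - measure_pmf.expectation q f\<bar>
      = \<bar>\<Sum>x\<in>UNIV. f x * (pmf p x - pmf q x)\<bar>"
    by (simp add: expectation_finite sum_subtractf right_diff_distrib)
  also have "\<dots> \<le> (\<Sum>x\<in>UNIV. B * \<bar>pmf p x - pmf q x\<bar>)"
    by (rule order_trans[OF sum_abs]) (auto simp: abs_mult intro!: sum_mono mult_right_mono assms)
  finally show ?thesis by (simp add: l1_dist_def sum_distrib_left)
qed

text \<open>Pointwise |a - b| = a + b - 2 min(a, b), and both masses are one. The distance is thus
  expressed by the overlap, the quantity whose infimum is \<open>dobrushin\<close>.\<close>

lemma l1_dist_eq_min:
  "l1_dist p q = 2 - 2 * (\<Sum>x\<in>UNIV. min (pmf p x) (pmf q x))"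
proof -
  have "l1_dist p q = (\<Sum>x\<in>UNIV. pmf p x + pmf q x - 2 * min (pmf p x) (pmf q x))"
    unfolding l1_dist_def by (intro sum.cong) (auto simp: min_def)
  then show ?thesis
    by (simp add: sum.distrib sum_subtractf sum_pmf_UNIV sum_distrib_left[symmetric])
qed

section \<open>The Dobrushin coefficient as a contraction factor\<close>

lemma bdd_below_dobrushin:
  "bdd_below {(\<Sum>A\<in>P. min (measure_pmf.prob (K x) A) (measure_pmf.prob (K y) A)) |x y P.
     finite P \<and> partition_on UNIV P}"
  by (rule bdd_belowI[of _ 0]) (auto intro!: sum_nonneg)

text \<open>On a finite target the partition into singletons is among those over which the infimum
  is taken.\<close>

lemma dobrushin_le:
  fixes K :: "'a \<Rightarrow> 'b::finite pmf"
  shows "dobrushin K \<le> (\<Sum>z\<in>UNIV. min (pmf (K x) z) (pmf (K y) z))"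
proof -
  let ?P = "(\<lambda>z::'b. {z}) ` UNIV"
  have part: "partition_on UNIV ?P"
    by (auto simp: partition_on_def disjoint_def)
  have "dobrushin K \<le> (\<Sum>A\<in>?P. min (measure_pmf.prob (K x) A) (measure_pmf.prob (K y) A))"
    unfolding dobrushin_def by (rule cInf_lower[OF _ bdd_below_dobrushin]) (use part in auto)
  also have "\<dots> = (\<Sum>z\<in>UNIV. min (pmf (K x) z) (pmf (K y) z))"
    by (subst sum.reindex) (auto simp: inj_on_def measure_pmf_single)
  finally show ?thesis .
qed

text \<open>A row overlaps with itself in mass one. The factors 1 - \<delta> and 2 - \<delta> are
  therefore nonnegative.\<close>

lemma dobrushin_le_1: "dobrushin (K :: 'a \<Rightarrow> 'b::finite pmf) \<le> 1"
proof -
  have "dobrushin K \<le> (\<Sum>z\<in>UNIV. min (pmf (K undefined) z) (pmf (K undefined) z))"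
    by (rule dobrushin_le)
  then show ?thesis by (simp add: sum_pmf_UNIV)
qed

lemma l1_dist_le_dobrushin: "l1_dist (K x) (K y) \<le> 2 * (1 - dobrushin K)"
  using dobrushin_le[of K x y] by (simp add: l1_dist_eq_min)

text \<open>The positive and negative parts \<open>a\<close>, \<open>b\<close> of \<open>p - q\<close> have the same mass \<open>m\<close>, so
  \<open>m (p - q) K\<close> is the \<open>a \<otimes> b\<close>-mixture of the differences \<open>K x - K x'\<close>.\<close>

lemma l1_dist_bind_le:
  fixes p q :: "'a::finite pmf" and K :: "'a \<Rightarrow> 'b::finite pmf"
  shows "l1_dist (bind_pmf p K) (bind_pmf q K) \<le> (1 - dobrushin K) * l1_dist p q"
proof -
  define a where "a x = max 0 (pmf p x - pmf q x)" for x
  define b where "b x = max 0 (pmf q x - pmf p x)" for x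
  define m where "m = (\<Sum>x\<in>UNIV. a x)"
  have ab: "pmf p x - pmf q x = a x - b x" "\<bar>pmf p x - pmf q x\<bar> = a x + b x"
    and nonneg: "0 \<le> a x" "0 \<le> b x" for x
    by (auto simp: a_def b_def)
  have "(\<Sum>x\<in>UNIV. a x) - (\<Sum>x\<in>UNIV. b x) = 0"
    by (simp add: sum_subtractf[symmetric] ab(1)[symmetric]) (simp add: sum_subtractf sum_pmf_UNIV)
  then have m_b: "(\<Sum>x\<in>UNIV. b x) = m" by (simp add: m_def)
  have l1: "l1_dist p q = 2 * m"
    by (simp add: l1_dist_def ab(2) sum.distrib m_b m_def[symmetric])
  have "m \<ge> 0" using nonneg by (simp add: m_def sum_nonneg)
  have mix: "m * (pmf (bind_pmf p K) z - pmf (bind_pmf q K) z)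
      = (\<Sum>x\<in>UNIV. \<Sum>x'\<in>UNIV. a x * b x' * (pmf (K x) z - pmf (K x') z))" for z
  proof -
    have "pmf (bind_pmf p K) z - pmf (bind_pmf q K) z
        = (\<Sum>x\<in>UNIV. (pmf p x - pmf q x) * pmf (K x) z)"
      by (simp add: pmf_bind_finite sum_subtractf left_diff_distrib)
    also have "\<dots> = (\<Sum>x\<in>UNIV. a x * pmf (K x) z) - (\<Sum>x\<in>UNIV. b x * pmf (K x) z)"
      by (simp add: ab(1) sum_subtractf left_diff_distrib)
    finally have "m * (pmf (bind_pmf p K) z - pmf (bind_pmf q K) z)
        = m * (\<Sum>x\<in>UNIV. a x * pmf (K x) z) - m * (\<Sum>x\<in>UNIV. b x * pmf (K x) z)"
      by (simp only: right_diff_distrib)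
    \<comment> \<open>The factor \<open>m\<close> is read as the mass of \<open>b\<close> in the
      first term and as the mass of \<open>a\<close> in the second, so that both become sums over
      pairs.\<close>
    also have "\<dots> = (\<Sum>x\<in>UNIV. a x * pmf (K x) z) * (\<Sum>x'\<in>UNIV. b x')
        - (\<Sum>x\<in>UNIV. a x) * (\<Sum>x'\<in>UNIV. b x' * pmf (K x') z)"
      by (simp only: m_b m_def[symmetric] mult.commute)
    also have "\<dots> = (\<Sum>x\<in>UNIV. \<Sum>x'\<in>UNIV. a x * b x' * (pmf (K x) z - pmf (K x') z))"
      unfolding sum_product sum_subtractf[symmetric] by (intro sum.cong refl)
          (simp add: algebra_simps)
    finally show ?thesis .
  qed
  have "m * l1_dist (bind_pmf p K) (bind_pmf q K)
      = (\<Sum>z\<in>UNIV. \<bar>m * (pmf (bind_pmf p K) z - pmf (bind_pmf q K) z)\<bar>)"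
    using \<open>m \<ge> 0\<close> by (simp add: l1_dist_def abs_mult sum_distrib_left)
  also have "\<dots> \<le> (\<Sum>z\<in>UNIV. \<Sum>x\<in>UNIV. \<Sum>x'\<in>UNIV. a x * b x' * \<bar>pmf (K x) z - pmf (K x') z\<bar>)"
    unfolding mix
    by (intro sum_mono order_trans[OF sum_abs]) (simp add: abs_mult nonneg)
  also have "\<dots> = (\<Sum>x\<in>UNIV. \<Sum>x'\<in>UNIV. a x * b x' * l1_dist (K x) (K x'))"
    unfolding l1_dist_def sum_distrib_left
    by (subst sum.swap, rule sum.cong[OF refl], subst sum.swap, rule refl)
  also have "\<dots> \<le> (\<Sum>x\<in>UNIV. \<Sum>x'\<in>UNIV. a x * b x' * (2 * (1 - dobrushin K)))"
    by (intro sum_mono mult_left_mono l1_dist_le_dobrushin) (simp add: nonneg)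
  also have "\<dots> = m * m * (2 * (1 - dobrushin K))"
    by (simp add: sum_distrib_right[symmetric] sum_distrib_left[symmetric] m_b m_def[symmetric])
  finally have le: "m * l1_dist (bind_pmf p K) (bind_pmf q K) \<le> m * ((1 - dobrushin K) * l1_dist p q)"
    by (simp add: l1 algebra_simps)
  \<comment> \<open>Cancelling \<open>m\<close> requires \<open>m\<close> to be nonzero; for
    \<open>m = 0\<close> the two laws coincide.\<close>
  show ?thesis
  proof (cases "m = 0")
    case True
    then have "p = q"
      using l1 by (intro pmf_eqI) (simp add: l1_dist_def sum_nonneg_eq_0_iff)
    then show ?thesis by (simp add: l1_dist_def)
  next
    case False
    with le \<open>m \<ge> 0\<close> show ?thesis by simp
  qed
qed

lemma dobrushin_tilde_le: "dobrushin_tilde T \<le> dobrushin (\<lambda>x. T x u)"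
  for T :: "'x \<Rightarrow> 'u::finite \<Rightarrow> 'x pmf"
  unfolding dobrushin_tilde_def by (rule cINF_lower) auto

lemma dobrushin_tilde_le_1: "dobrushin_tilde T \<le> 1"
  for T :: "'x::finite \<Rightarrow> 'u::finite \<Rightarrow> 'x pmf"
  using dobrushin_tilde_le dobrushin_le_1 order_trans by blast

section \<open>Bayes updates in total variation\<close>

text \<open>Holds also when the observation has probability zero, both sides being zero.\<close>

lemma pmf_bayes_mult:
  fixes p :: "'x::finite pmf" and Ob :: "'x \<Rightarrow> 'y pmf"
  shows "pmf (bind_pmf p Ob) y * pmf (bayes \<rho> Ob p y) x = pmf (Ob x) y * pmf p x"
proof -
  have Z: "pmf (bind_pmf p Ob) y = measure_pmf.expectation p (\<lambda>x. pmf (Ob x) y)"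
    by (simp add: pmf_bind)
  show ?thesis
  proof (cases "pmf (bind_pmf p Ob) y = 0")
    case True
    then have "(\<Sum>x\<in>UNIV. pmf p x * pmf (Ob x) y) = 0" by (simp add: pmf_bind_finite)
    then have "pmf p x * pmf (Ob x) y = 0" by (subst (asm) sum_nonneg_eq_0_iff) auto
    with True show ?thesis by auto
  next
    case False
    then show ?thesis by (simp add: pmf_bayes Z)
  qed
qed

text \<open>By \<open>pmf_bayes_mult\<close> both sampling orders, state first or observation first,
  give each pair (x, y) the same weight. The default \<open>\<rho>\<close> occurs with weight zero
  only.\<close>

lemma bind_pmf_bayes:
  fixes p :: "'x::finite pmf" and Ob :: "'x \<Rightarrow> 'y::finite pmf"
  shows "bind_pmf p (\<lambda>x. bind_pmf (Ob x) (F x))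
    = bind_pmf (bind_pmf p Ob) (\<lambda>y. bind_pmf (bayes \<rho> Ob p y) (\<lambda>x. F x y))"
proof (rule pmf_eqI)
  fix z
  have "pmf (bind_pmf p (\<lambda>x. bind_pmf (Ob x) (F x))) z
      = (\<Sum>x\<in>UNIV. \<Sum>y\<in>UNIV. pmf (Ob x) y * pmf p x * pmf (F x y) z)"
    by (simp add: pmf_bind_finite sum_distrib_left mult_ac)
  also have "\<dots> = (\<Sum>y\<in>UNIV. \<Sum>x\<in>UNIV. pmf (bind_pmf p Ob) y * pmf (bayes \<rho> Ob p y) x * pmf (F x y) z)"
    unfolding pmf_bayes_mult by (rule sum.swap)
  also have "\<dots> = pmf (bind_pmf (bind_pmf p Ob) (\<lambda>y. bind_pmf (bayes \<rho> Ob p y) (\<lambda>x. F x y))) z"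
    by (simp add: pmf_bind_finite[where K = "\<lambda>y. bind_pmf (bayes \<rho> Ob p y) (\<lambda>x. F x y)"]
        pmf_bind_finite[where K = "\<lambda>x. F x y" for y] sum_distrib_left mult_ac)
  finally show "pmf (bind_pmf p (\<lambda>x. bind_pmf (Ob x) (F x))) z = \<dots>" .
qed

text \<open>With Z the observation law and B the posterior, Z_p (B_p - B_q) = (Z_p B_p - Z_q B_q) -
  (Z_p - Z_q) B_q. The unnormalized posteriors in the first term differ in total by the distance of
  the priors. The second term sums to the distance of the observation laws, at most 1 - \<delta>(O)
  times that. Together this makes 2 - \<delta>(O).\<close>

lemma expectation_l1_dist_bayes_le:
  fixes p q :: "'x::finite pmf" and Ob :: "'x \<Rightarrow> 'y::finite pmf"
  shows "measure_pmf.expectation (bind_pmf p Ob) (\<lambda>y. l1_dist (bayes \<rho> Ob p y) (bayes \<rho> Ob q y))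
    \<le> (2 - dobrushin Ob) * l1_dist p q"
proof -
  let ?Z = "\<lambda>p y. pmf (bind_pmf p Ob) y" and ?B = "\<lambda>p y x. pmf (bayes \<rho> Ob p y) x"
  have "?Z p y * \<bar>?B p y x - ?B q y x\<bar>
      \<le> pmf (Ob x) y * \<bar>pmf p x - pmf q x\<bar> + \<bar>?Z p y - ?Z q y\<bar> * ?B q y x" for x y
  proof -
    have "?Z p y * (?B p y x - ?B q y x)
        = (?Z p y * ?B p y x - ?Z q y * ?B q y x) - (?Z p y - ?Z q y) * ?B q y x"
      by (simp add: algebra_simps)
    also have "\<dots> = pmf (Ob x) y * (pmf p x - pmf q x) - (?Z p y - ?Z q y) * ?B q y x"
      by (simp add: pmf_bayes_mult right_diff_distrib)
    also have "\<bar>\<dots>\<bar> \<le> \<bar>pmf (Ob x) y * (pmf p x - pmf q x)\<bar> + \<bar>(?Z p y - ?Z q y) * ?B q y x\<bar>"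
      by (rule abs_triangle_ineq4)
    finally show ?thesis by (simp add: abs_mult)
  qed
  then have "(\<Sum>y\<in>UNIV. \<Sum>x\<in>UNIV. ?Z p y * \<bar>?B p y x - ?B q y x\<bar>)
      \<le> (\<Sum>y\<in>UNIV. \<Sum>x\<in>UNIV. pmf (Ob x) y * \<bar>pmf p x - pmf q x\<bar> + \<bar>?Z p y - ?Z q y\<bar> * ?B q y x)"
    by (intro sum_mono)
  also have "\<dots> = (\<Sum>y\<in>UNIV. \<Sum>x\<in>UNIV. pmf (Ob x) y * \<bar>pmf p x - pmf q x\<bar>)
      + l1_dist (bind_pmf p Ob) (bind_pmf q Ob)"
    by (simp add: sum.distrib sum_distrib_left[symmetric] sum_pmf_UNIV l1_dist_def)
  also have "(\<Sum>y\<in>UNIV. \<Sum>x\<in>UNIV. pmf (Ob x) y * \<bar>pmf p x - pmf q x\<bar>) = l1_dist p q"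
    by (subst sum.swap) (simp add: sum_distrib_right[symmetric] sum_pmf_UNIV l1_dist_def)
  finally show ?thesis
    using l1_dist_bind_le[of p Ob q]
    by (simp add: expectation_finite l1_dist_def[of "bayes _ _ _ _"] sum_distrib_left algebra_simps)
qed

section \<open>Expectations of bounded functions under discrete laws\<close>

lemma expectation_bind_pmf:
  fixes f :: "'b \<Rightarrow> real"
  assumes "\<And>x. \<bar>f x\<bar> \<le> B"
  shows "measure_pmf.expectation (bind_pmf p K) f
    = measure_pmf.expectation p (\<lambda>x. measure_pmf.expectation (K x) f)"
  unfolding measure_pmf_bind
  by (rule integral_bind[where K = "count_space UNIV" and B' = 1 and B = B])
     (auto simp: assms measure_pmf.emeasure_space_1 measure_pmf.finite_measure_axioms
       space_subprob_algebra measure_pmf.subprob_space_axioms)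

lemma integrable_pmf_bounded: "(\<And>x. \<bar>f x\<bar> \<le> B) \<Longrightarrow> integrable (measure_pmf p) f"
  for f :: "'b \<Rightarrow> real"
  by (rule measure_pmf.integrable_const_bound[where B = B]) auto

lemma abs_expectation_le:
  fixes f :: "'b \<Rightarrow> real"
  assumes "\<And>x. \<bar>f x\<bar> \<le> B"
  shows "\<bar>measure_pmf.expectation p f\<bar> \<le> B"
proof -
  have f: "integrable p f" using assms by (rule integrable_pmf_bounded)
  have "\<bar>measure_pmf.expectation p f\<bar> \<le> measure_pmf.expectation p (\<lambda>x. \<bar>f x\<bar>)"
    by (rule integral_abs_bound)
  also have "\<dots> \<le> measure_pmf.expectation p (\<lambda>x. B)"
    using f by (intro integral_mono) (auto simp: assms)
  finally show ?thesis by simp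
qed

lemma expectation_cong_on:
  fixes f g :: "'b \<Rightarrow> real"
  assumes "\<And>x. x \<in> set_pmf p \<Longrightarrow> f x = g x"
  shows "measure_pmf.expectation p f = measure_pmf.expectation p g"
  by (rule integral_cong_AE) (auto simp: AE_measure_pmf_iff assms)

text \<open>Records are lists, and inequalities about them hold only for lists of the right length,
  that is, on the support. The global bounds supply integrability.\<close>

lemma expectation_mono_on:
  fixes f g :: "'b \<Rightarrow> real"
  assumes "\<And>x. x \<in> set_pmf p \<Longrightarrow> f x \<le> g x" "\<And>x. \<bar>f x\<bar> \<le> B" "\<And>x. \<bar>g x\<bar> \<le> C"
  shows "measure_pmf.expectation p f \<le> measure_pmf.expectation p g"
proof (rule integral_mono_AE)
  show "integrable p f" "integrable p g"
    using assms(2,3) by (auto intro: integrable_pmf_bounded)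
qed (auto simp: AE_measure_pmf_iff assms)

lemma expectation_le_const:
  fixes f :: "'b \<Rightarrow> real"
  assumes "\<And>x. f x \<le> B" "\<And>x. \<bar>f x\<bar> \<le> C"
  shows "measure_pmf.expectation p f \<le> B"
  using expectation_mono_on[of p f "\<lambda>_. B" C "\<bar>B\<bar>"] assms by simp

section \<open>Filters and observable histories\<close>

lemma posterior_eq_bayes_predictor:
  "posterior \<rho> T Ob p y u n = bayes \<rho> Ob (predictor \<rho> T Ob p y u n) (y n)"
  by (cases n) (simp_all add: predictor_def)

lemma predictor_0: "predictor \<rho> T Ob p y u 0 = p"
  and predictor_Suc:
    "predictor \<rho> T Ob p y u (Suc n) = bind_pmf (posterior \<rho> T Ob p y u n) (\<lambda>x. T x (u n))"
  by (simp_all add: predictor_def)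

lemma posterior_cong:
  assumes "\<And>i. i \<le> n \<Longrightarrow> y i = y' i" "\<And>i. i < n \<Longrightarrow> u i = u' i"
  shows "posterior \<rho> T Ob p y u n = posterior \<rho> T Ob p y' u' n"
  using assms by (induction n) simp_all

lemma predictor_cong:
  assumes "\<And>i. i < n \<Longrightarrow> y i = y' i" "\<And>i. i < n \<Longrightarrow> u i = u' i"
  shows "predictor \<rho> T Ob p y u n = predictor \<rho> T Ob p y' u' n"
  using assms posterior_cong[of "n - 1" y y' u u' \<rho> T Ob p] by (cases n) (simp_all add: predictor_def)

text \<open>Semigroup property of the filter: the problem restarted at time \<open>m\<close> with
  the predictor as prior has the same filters as the original one.\<close>

lemma predictor_add:
  "predictor \<rho> T Ob (predictor \<rho> T Ob p y u m) (\<lambda>i. y (m + i)) (\<lambda>i. u (m + i)) k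
    = predictor \<rho> T Ob p y u (m + k)"
proof (induction k)
  case 0
  then show ?case by (simp add: predictor_0)
next
  case (Suc k)
  then show ?case
    by (simp add: predictor_Suc posterior_eq_bayes_predictor del: posterior.simps)
qed

locale pomdp =
  fixes T :: "'x::finite \<Rightarrow> 'u::finite \<Rightarrow> 'x pmf"
    and Ob :: "'x \<Rightarrow> 'y::finite pmf"
    and \<rho> :: "'x pmf"
begin

abbreviation post :: "'x pmf \<Rightarrow> 'y list \<Rightarrow> 'u list \<Rightarrow> nat \<Rightarrow> 'x pmf" where
  "post p ys us \<equiv> posterior \<rho> T Ob p ((!) ys) ((!) us)"

abbreviation pred :: "'x pmf \<Rightarrow> 'y list \<Rightarrow> 'u list \<Rightarrow> nat \<Rightarrow> 'x pmf" where
  "pred p ys us \<equiv> predictor \<rho> T Ob p ((!) ys) ((!) us)"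

lemma post_append_action: "length us = n \<Longrightarrow> post p ys (us @ us') n = post p ys us n"
  by (rule posterior_cong) (simp_all add: nth_append)

lemma post_append_observation:
  "length ys = n \<Longrightarrow> post p (ys @ [y]) us n = bayes \<rho> Ob (pred p ys us n) y"
  unfolding posterior_eq_bayes_predictor
  by (auto simp: nth_append intro!: arg_cong2[where f = "bayes \<rho> Ob"] predictor_cong)

lemma pred_Suc_append_action:
  "length us = n \<Longrightarrow> pred p ys (us @ [u]) (Suc n) = bind_pmf (post p ys us n) (\<lambda>x. T x u)"
  using post_append_action[of us n p ys "[u]"] by (auto simp: predictor_Suc)

lemma pred_append:
  assumes "length ys = n" "length us = n"
  shows "pred p (ys @ ys') (us @ us') (n + k) = pred (pred p ys us n) ys' us' k"
proof -
  have "predictor \<rho> T Ob p ((!) (ys @ ys')) ((!) (us @ us')) n = pred p ys us n"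
    using assms by (intro predictor_cong) (simp_all add: nth_append)
  moreover have "(\<lambda>i. (ys @ ys') ! (n + i)) = (!) ys'" "(\<lambda>i. (us @ us') ! (n + i)) = (!) us'"
    using assms by (auto simp: nth_append)
  ultimately show ?thesis
    using predictor_add[of \<rho> T Ob p "(!) (ys @ ys')" "(!) (us @ us')" n k] by simp
qed

section \<open>Laws of the observable data\<close>

text \<open>\<open>data_before p g n\<close> is the law of \<open>(Y\<^bsub>[0,n-1]\<^esub>, U\<^bsub>[0,n-1]\<^esub>)\<close> and \<open>data_at p g n\<close> that of
  \<open>(Y\<^bsub>[0,n]\<^esub>, U\<^bsub>[0,n-1]\<^esub>)\<close> when \<open>X\<^sub>0\<close> has law \<open>p\<close> and \<open>g\<close> is used.\<close>

primrec data_before :: "'x pmf \<Rightarrow> ('y, 'u) policy \<Rightarrow> nat \<Rightarrow> ('y list \<times> 'u list) pmf" where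
  "data_before p g 0 = return_pmf ([], [])"
| "data_before p g (Suc n) = bind_pmf (data_before p g n) (\<lambda>(ys, us).
     bind_pmf (bind_pmf (pred p ys us n) Ob) (\<lambda>y.
     map_pmf (\<lambda>u. (ys @ [y], us @ [u])) (g (ys @ [y]) us)))"

definition data_at :: "'x pmf \<Rightarrow> ('y, 'u) policy \<Rightarrow> nat \<Rightarrow> ('y list \<times> 'u list) pmf" where
  "data_at p g n = bind_pmf (data_before p g n) (\<lambda>(ys, us).
     map_pmf (\<lambda>y. (ys @ [y], us)) (bind_pmf (pred p ys us n) Ob))"

lemma data_before_Suc_eq:
  "data_before p g (Suc n)
    = bind_pmf (data_at p g n) (\<lambda>(ys, us). map_pmf (\<lambda>u. (ys, us @ [u])) (g ys us))"
  by (simp add: data_at_def bind_assoc_pmf bind_map_pmf case_prod_unfold)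

lemma length_data_before:
  "h \<in> set_pmf (data_before p g n) \<Longrightarrow> length (fst h) = n \<and> length (snd h) = n"
  by (induction n arbitrary: h) (fastforce simp del: bind_assoc_pmf)+

lemma length_data_at:
  "h \<in> set_pmf (data_at p g n) \<Longrightarrow> length (fst h) = Suc n \<and> length (snd h) = n"
  by (auto simp: data_at_def dest!: length_data_before)

text \<open>One time step as action, transition and observation, all governed by the posterior. The
  stability and Bellman arguments proceed along this recursion.\<close>

lemma data_at_Suc:
  "data_at p g (Suc n) = bind_pmf (data_at p g n) (\<lambda>(ys, us). bind_pmf (g ys us) (\<lambda>u.
     map_pmf (\<lambda>y. (ys @ [y], us @ [u]))
       (bind_pmf (bind_pmf (post p ys us n) (\<lambda>x. T x u)) Ob)))"
proof -
  have "data_at p g (Suc n) = bind_pmf (data_at p g n) (\<lambda>(ys, us). bind_pmf (g ys us) (\<lambda>u.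
     map_pmf (\<lambda>y. (ys @ [y], us @ [u])) (bind_pmf (pred p ys (us @ [u]) (Suc n)) Ob)))"
    unfolding data_at_def[of _ _ "Suc n"] data_before_Suc_eq
    by (simp add: bind_assoc_pmf bind_map_pmf case_prod_unfold)
  also have "\<dots> = bind_pmf (data_at p g n) (\<lambda>(ys, us). bind_pmf (g ys us) (\<lambda>u.
     map_pmf (\<lambda>y. (ys @ [y], us @ [u]))
       (bind_pmf (bind_pmf (post p ys us n) (\<lambda>x. T x u)) Ob)))"
    by (auto dest!: length_data_at simp: pred_Suc_append_action intro!: bind_pmf_cong)
  finally show ?thesis .
qed

text \<open>At time t a policy sees t + 1 observations, so the test \<open>length ys \<le> n\<close>
  lets \<open>g\<close> act exactly before time \<open>n\<close>. Afterwards \<open>f\<close> gets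
  the earlier record separately, and its later arguments look like those of a problem started at
  time 0.\<close>

definition switch_policy ::
  "nat \<Rightarrow> ('y, 'u) policy \<Rightarrow> ('y list \<times> 'u list \<Rightarrow> ('y, 'u) policy) \<Rightarrow> ('y, 'u) policy" where
  "switch_policy n g f = (\<lambda>ys us. if length ys \<le> n then g ys us
     else f (take n ys, take n us) (drop n ys) (drop n us))"

lemma data_before_switch_policy_le:
  "k \<le> n \<Longrightarrow> data_before p (switch_policy n g f) k = data_before p g k"
proof (induction k)
  case (Suc k)
  then show ?case
    by (auto simp: switch_policy_def dest!: length_data_before intro!: bind_pmf_cong)
qed simp

text \<open>After the record \<open>h\<close> the filter continues as one restarted from the
  predictor at time \<open>n\<close> (\<open>pred_append\<close>), so the later data have the law of
  the restarted problem under \<open>f h\<close>.\<close>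

lemma data_before_switch_policy:
  "data_before p (switch_policy n g f) (n + k) = bind_pmf (data_before p g n) (\<lambda>h.
     map_pmf (\<lambda>h'. (fst h @ fst h', snd h @ snd h')) (data_before (pred p (fst h) (snd h) n)
         (f h) k))"
proof (induction k)
  case 0
  then show ?case by (simp add: data_before_switch_policy_le bind_return_pmf')
next
  case (Suc k)
  show ?case
    unfolding add_Suc_right data_before.simps Suc
    by (simp add: bind_assoc_pmf bind_map_pmf map_bind_pmf case_prod_unfold, intro bind_pmf_cong refl)
       (auto dest!: length_data_before simp: switch_policy_def pred_append[OF refl] map_pmf_comp
         intro!: bind_pmf_cong)
qed

lemma data_at_switch_policy:
  "data_at p (switch_policy n g f) (n + k) = bind_pmf (data_before p g n) (\<lambda>h.
     map_pmf (\<lambda>h'. (fst h @ fst h', snd h @ snd h')) (data_at (pred p (fst h) (snd h) n) (f h) k))"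
  unfolding data_at_def data_before_switch_policy
  by (simp add: bind_assoc_pmf bind_map_pmf map_bind_pmf case_prod_unfold, intro bind_pmf_cong refl)
     (auto dest!: length_data_before simp: pred_append[OF refl] map_pmf_comp intro!: bind_pmf_cong)

end

section \<open>Marginals of the trajectory law\<close>

lemma step_pmf_cong:
  assumes "\<And>i. i < n \<Longrightarrow> \<omega> i = \<omega>' i"
  shows "step_pmf T Ob p g n \<omega> = step_pmf T Ob p g n \<omega>'"
proof -
  have *: "map (\<lambda>k. ob (\<omega> k)) [0..<n] = map (\<lambda>k. ob (\<omega>' k)) [0..<n]"
    "map (\<lambda>k. ac (\<omega> k)) [0..<n] = map (\<lambda>k. ac (\<omega>' k)) [0..<n]"
    using assms by simp_all
  show ?thesis
    unfolding step_pmf_def * using assms by (auto split: nat.split)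
qed

text \<open>Discrete counterpart of the finite-dimensional marginals of \<open>traj\<close>, with
  lists of triples in place of functions on an initial segment.\<close>

primrec prefix_pmf ::
  "('x \<Rightarrow> 'u \<Rightarrow> 'x pmf) \<Rightarrow> ('x \<Rightarrow> 'y pmf) \<Rightarrow> 'x pmf \<Rightarrow> ('y, 'u) policy
     \<Rightarrow> nat \<Rightarrow> ('x \<times> 'y \<times> 'u) list pmf" where
  "prefix_pmf T Ob p g 0 = return_pmf []"
| "prefix_pmf T Ob p g (Suc n) = bind_pmf (prefix_pmf T Ob p g n) (\<lambda>zs.
     map_pmf (\<lambda>z. zs @ [z]) (step_pmf T Ob p g n ((!) zs)))"

lemma length_prefix_pmf: "zs \<in> set_pmf (prefix_pmf T Ob p g n) \<Longrightarrow> length zs = n"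
  by (induction n arbitrary: zs) fastforce+

context pomdp
begin

context
  fixes p :: "'x pmf" and g :: "('y, 'u) policy"
begin

interpretation IT: Ionescu_Tulcea
  "\<lambda>t \<omega>. measure_pmf (step_pmf T Ob p g t \<omega>)"
  "\<lambda>_. count_space (UNIV :: ('x \<times> 'y \<times> 'u) set)"
  by (rule Ionescu_Tulcea_step_pmf)

text \<open>Finitely many finite coordinates carry the full power set as sigma-algebra, which makes
  measurability on prefixes automatic.\<close>

lemma PiM_prefix:
  "PiM {0..<n} (\<lambda>_. count_space (UNIV :: ('x \<times> 'y \<times> 'u) set))
    = count_space (PiE {0..<n} (\<lambda>_. UNIV))" for n :: nat
  by (rule count_space_PiM_finite) auto

text \<open>Both laws append one coordinate at a time by the same kernel. The constant
  \<open>undefined\<close> is the unique function on the empty index set, from which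
  \<open>IT.C\<close> starts.\<close>

lemma nn_integral_IT_C:
  fixes F :: "('x \<times> 'y \<times> 'u) list \<Rightarrow> ennreal"
  shows "(\<integral>\<^sup>+\<omega>. F (map \<omega> [0..<n]) \<partial>IT.C 0 n (\<lambda>_. undefined)) = (\<integral>\<^sup>+zs. F zs \<partial>prefix_pmf T Ob p g n)"
proof (induction n arbitrary: F)
  case 0
  have "(\<lambda>_. undefined) \<in> space (PiM {0..<0} (\<lambda>_. count_space (UNIV :: ('x \<times> 'y \<times> 'u) set)))"
    by (auto simp: space_PiM)
  then show ?case
    by (simp add: nn_integral_return)
next
  case (Suc n)
  let ?M = "\<lambda>_::nat. count_space (UNIV :: ('x \<times> 'y \<times> 'u) set)"
  let ?u = "\<lambda>_::nat. undefined :: 'x \<times> 'y \<times> 'u"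
  have u: "?u \<in> space (PiM {0..<0} ?M)" by (auto simp: space_PiM)
  have sets: "sets (IT.C 0 n ?u) = sets (PiM {0..<n} ?M)"
    using IT.sets_C[OF u, of n] by simp
  have space: "space (IT.C 0 n ?u) = space (PiM {0..<n} ?M)"
    using sets by (rule sets_eq_imp_space_eq)
  have meas: "(\<lambda>\<omega>. F (map \<omega> [0..<Suc n])) \<in> borel_measurable (PiM {0..<Suc n} ?M)"
    unfolding PiM_prefix by simp
  have "(\<integral>\<^sup>+\<omega>. F (map \<omega> [0..<Suc n]) \<partial>IT.C 0 (Suc n) ?u)
      = (\<integral>\<^sup>+\<omega>. \<integral>\<^sup>+\<omega>'. F (map \<omega>' [0..<Suc n]) \<partial>IT.eP n \<omega> \<partial>IT.C 0 n ?u)"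
    unfolding IT.C.simps add_0
    by (rule nn_integral_bind[OF meas]) (simp add: measurable_cong_sets[OF sets refl]
        IT.measurable_eP)
  also have "\<dots> = (\<integral>\<^sup>+\<omega>. \<integral>\<^sup>+z. F (map \<omega> [0..<n] @ [z]) \<partial>step_pmf T Ob p g n ((!) (map \<omega> [0..<n]))
      \<partial>IT.C 0 n ?u)"
  proof (rule nn_integral_cong)
    fix \<omega> assume "\<omega> \<in> space (IT.C 0 n ?u)"
    then have \<omega>: "\<omega> \<in> space (PiM {0..<n} ?M)" by (simp only: space)
    have map: "map (fun_upd \<omega> n z) [0..<Suc n] = map \<omega> [0..<n] @ [z]" for z
      by simp
    have "step_pmf T Ob p g n \<omega> = step_pmf T Ob p g n ((!) (map \<omega> [0..<n]))"
      by (rule step_pmf_cong) simp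
    then show "(\<integral>\<^sup>+\<omega>'. F (map \<omega>' [0..<Suc n]) \<partial>IT.eP n \<omega>)
        = (\<integral>\<^sup>+z. F (map \<omega> [0..<n] @ [z]) \<partial>step_pmf T Ob p g n ((!) (map \<omega> [0..<n])))"
      by (simp only: IT.nn_integral_eP[OF \<omega> meas] map)
  qed
  also have "\<dots> = (\<integral>\<^sup>+zs. F zs \<partial>prefix_pmf T Ob p g (Suc n))"
    by (subst Suc.IH) simp
  finally show ?case .
qed

lemma prob_space_traj: "prob_space (traj T Ob p g)"
  and measurable_traj_prefix:
    "(\<lambda>\<omega>. map \<omega> [0..<n]) \<in> measurable (traj T Ob p g) (count_space UNIV)" (is ?meas)
  and distr_traj_prefix:
    "distr (traj T Ob p g) (count_space UNIV) (\<lambda>\<omega>. map \<omega> [0..<n]) = prefix_pmf T Ob p g n" (is ?distr)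
proof -
  let ?M = "\<lambda>_::nat. count_space (UNIV :: ('x \<times> 'y \<times> 'u) set)"
  let ?u = "\<lambda>_::nat. undefined :: 'x \<times> 'y \<times> 'u"
  have u: "?u \<in> space (PiM {0..<0} ?M)" by (auto simp: space_PiM)
  have traj: "traj T Ob p g = IT.PF.lim" by (simp add: traj_def)
  have sets: "sets (traj T Ob p g) = sets (PiM UNIV ?M)" by (simp add: traj)
  then have space: "space (traj T Ob p g) = UNIV"
    by (simp add: sets_eq_imp_space_eq[OF sets] space_PiM)
  \<comment> \<open>An event about the first \<open>n\<close> triples is a cylinder, and on
    cylinders the projective limit is given by \<open>IT.C\<close>.\<close>
  have emb: "(\<lambda>\<omega>. map \<omega> [0..<n]) -` X
      = prod_emb UNIV ?M {0..<n} {\<omega> \<in> PiE {0..<n} (\<lambda>_. UNIV). map \<omega> [0..<n] \<in> X}" for X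
  proof -
    have "map (restrict \<omega> {0..<n}) [0..<n] = map \<omega> [0..<n]" for \<omega> :: "nat \<Rightarrow> 'x \<times> 'y \<times> 'u"
      by simp
    then show ?thesis by (auto simp: prod_emb_def space_PiM simp del: map_eq_conv)
  qed
  have in_sets: "{\<omega> \<in> PiE {0..<n} (\<lambda>_. UNIV). map \<omega> [0..<n] \<in> X} \<in> sets (PiM {0..<n} ?M)" for X
    unfolding PiM_prefix by auto
  show meas: ?meas
  proof (rule measurableI)
    fix X :: "('x \<times> 'y \<times> 'u) list set"
    have "prod_emb UNIV ?M {0..<n} {\<omega> \<in> PiE {0..<n} (\<lambda>_. UNIV). map \<omega> [0..<n] \<in> X} \<in> sets
        (PiM UNIV ?M)"
      by (rule measurable_prod_emb[OF _ in_sets]) simp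
    then show "(\<lambda>\<omega>. map \<omega> [0..<n]) -` X \<inter> space (traj T Ob p g) \<in> sets (traj T Ob p g)"
      by (simp only: space sets emb Int_UNIV_right)
  qed simp
  show distr: ?distr
  proof (rule measure_eqI)
    fix X assume "X \<in> sets (distr (traj T Ob p g) (count_space UNIV) (\<lambda>\<omega>. map \<omega> [0..<n]))"
    let ?X = "{\<omega> \<in> PiE {0..<n} (\<lambda>_. UNIV). map \<omega> [0..<n] \<in> X}"
    have "emeasure (distr (traj T Ob p g) (count_space UNIV) (\<lambda>\<omega>. map \<omega> [0..<n])) X
        = emeasure (traj T Ob p g) (prod_emb UNIV ?M {0..<n} ?X)"
      by (subst emeasure_distr[OF meas]) (simp_all add: space emb)
    also have "\<dots> = emeasure (IT.C 0 n ?u) (prod_emb {0..<n} ?M {0..<n} ?X)"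
      unfolding traj
      by (subst IT.lim[OF _ in_sets])
         (simp_all only: IT.emeasure_CI[OF subset_refl in_sets] finite_atLeastLessThan)
    also have "prod_emb {0..<n} ?M {0..<n} ?X = ?X"
      by (rule prod_emb_id) (auto simp: space_PiM)
    also have "emeasure (IT.C 0 n ?u) ?X = (\<integral>\<^sup>+\<omega>. indicator X (map \<omega> [0..<n]) \<partial>IT.C 0 n ?u)"
    proof -
      have sC: "sets (IT.C 0 n ?u) = sets (PiM {0..<n} ?M)"
        using IT.sets_C[OF u, of n] by simp
      have "emeasure (IT.C 0 n ?u) ?X = (\<integral>\<^sup>+\<omega>. indicator ?X \<omega> \<partial>IT.C 0 n ?u)"
        by (rule nn_integral_indicator[symmetric]) (simp only: sC in_sets)
      also have "\<dots> = (\<integral>\<^sup>+\<omega>. indicator X (map \<omega> [0..<n]) \<partial>IT.C 0 n ?u)"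
        by (rule nn_integral_cong)
           (auto simp: sets_eq_imp_space_eq[OF sC] space_PiM indicator_def)
      finally show ?thesis .
    qed
    also have "\<dots> = emeasure (prefix_pmf T Ob p g n) X"
      by (simp add: nn_integral_IT_C)
    finally show "emeasure (distr (traj T Ob p g) (count_space UNIV) (\<lambda>\<omega>. map \<omega> [0..<n])) X
        = emeasure (prefix_pmf T Ob p g n) X" .
  qed simp
  \<comment> \<open>Total mass one is inherited from the image law, which is a pmf.\<close>
  have "prob_space (distr (traj T Ob p g) (count_space UNIV) (\<lambda>\<omega>. map \<omega> [0..<n]))"
    unfolding distr by (rule measure_pmf.prob_space_axioms)
  then show "prob_space (traj T Ob p g)"
    by (rule prob_space_distrD[OF meas])
qed

lemma integral_traj_prefix:
  fixes F :: "('x \<times> 'y \<times> 'u) list \<Rightarrow> real"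
  shows "(\<integral>\<omega>. F (map \<omega> [0..<n]) \<partial>traj T Ob p g) = measure_pmf.expectation (prefix_pmf T Ob p g n) F"
  unfolding distr_traj_prefix[symmetric]
  by (subst integral_distr[OF measurable_traj_prefix]) auto

end

text \<open>Identifies the recursively defined filter as the true conditional law of the state given
  the data; the action, drawn from the data alone, is conditionally independent of that
  state.\<close>

lemma prefix_pmf_filter:
  "map_pmf (\<lambda>zs. (map ob zs, map ac zs, st (last zs))) (prefix_pmf T Ob p g (Suc n))
    = bind_pmf (data_at p g n) (\<lambda>(ys, us). bind_pmf (g ys us) (\<lambda>u.
        map_pmf (\<lambda>x. (ys, us @ [u], x)) (post p ys us n)))"
proof -
  \<comment> \<open>\<open>N\<close> and \<open>D\<close> are the laws of the data before time n
    with the state at n, computed from the trajectory and from the filter. \<open>R\<close> and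
    \<open>L\<close> are the same laws after observation and action at n are added. Both pairs are
    linked by the same kernel, and \<open>step\<close> leads from time n to n + 1.\<close>
  define nxt where "nxt n zs = (case n of 0 \<Rightarrow> p | Suc s \<Rightarrow> T (st (zs ! s)) (ac (zs ! s)))"
      for n and zs :: "('x \<times> 'y \<times> 'u) list"
  define R where "R n = map_pmf (\<lambda>zs. (map ob zs, map ac zs, st (last zs))) (prefix_pmf T Ob p g
      (Suc n))" for n
  define L where "L n = bind_pmf (data_at p g n) (\<lambda>(ys, us). bind_pmf (g ys us) (\<lambda>u.
        map_pmf (\<lambda>x. (ys, us @ [u], x)) (post p ys us n)))" for n
  define N where "N n = bind_pmf (prefix_pmf T Ob p g n) (\<lambda>zs. map_pmf (\<lambda>x.
      (map ob zs, map ac zs, x)) (nxt n zs))" for n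
  define D where "D n = bind_pmf (data_before p g n) (\<lambda>h. map_pmf (\<lambda>x. (fst h, snd h, x)) (pred p
      (fst h) (snd h) n))" for n
  have R: "R n = bind_pmf (N n) (\<lambda>(ys, us, x). bind_pmf (Ob x) (\<lambda>y. map_pmf
      (\<lambda>u. (ys @ [y], us @ [u], x)) (g (ys @ [y]) us)))" for n
  proof -
    have "step_pmf T Ob p g n ((!) zs) = bind_pmf (nxt n zs) (\<lambda>x. bind_pmf (Ob x) (\<lambda>y.
        map_pmf (\<lambda>u. (x, y, u)) (g (map ob zs @ [y]) (map ac zs))))"
      if "zs \<in> set_pmf (prefix_pmf T Ob p g n)" for zs
    proof -
      have "map (\<lambda>k. ob (zs ! k)) [0..<n] = map ob zs" "map (\<lambda>k. ac (zs ! k)) [0..<n] = map ac zs"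
        using length_prefix_pmf[OF that] by (auto intro: nth_equalityI)
      then show ?thesis by (simp add: step_pmf_def nxt_def map_pmf_def)
    qed
    then have "prefix_pmf T Ob p g (Suc n) = bind_pmf (prefix_pmf T Ob p g n) (\<lambda>zs. map_pmf
        (\<lambda>z. zs @ [z])
        (bind_pmf (nxt n zs) (\<lambda>x. bind_pmf (Ob x) (\<lambda>y. map_pmf (\<lambda>u. (x, y, u)) (g
            (map ob zs @ [y]) (map ac zs))))))"
      by (auto intro!: bind_pmf_cong)
    then show ?thesis
      by (simp add: R_def N_def map_bind_pmf bind_assoc_pmf bind_map_pmf map_pmf_comp)
  qed
  have L: "L n = bind_pmf (D n) (\<lambda>(ys, us, x). bind_pmf (Ob x) (\<lambda>y. map_pmf
      (\<lambda>u. (ys @ [y], us @ [u], x)) (g (ys @ [y]) us)))" for n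
  proof -
    have "bind_pmf (pred p (fst h) (snd h) n) (\<lambda>x. bind_pmf (Ob x) (\<lambda>y. map_pmf (\<lambda>u.
        (fst h @ [y], snd h @ [u], x)) (g (fst h @ [y]) (snd h))))
      = bind_pmf (bind_pmf (pred p (fst h) (snd h) n) Ob) (\<lambda>y. bind_pmf (g (fst h @ [y]) (snd h)) (\<lambda>u.
          map_pmf (\<lambda>x. (fst h @ [y], snd h @ [u], x)) (post p (fst h @ [y]) (snd h) n)))"
      if "h \<in> set_pmf (data_before p g n)" for h
    proof -
      have *: "post p (fst h @ [y]) (snd h) n = bayes \<rho> Ob (pred p (fst h) (snd h) n) y" for y
        using post_append_observation[of "fst h" n p y "snd h"] length_data_before[OF that] by simp
      \<comment> \<open>Bayes' rule lets the observation be drawn before the state; the action then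
        commutes with the state, as its law reads only the data.\<close>
      show ?thesis
        unfolding *
        by (subst bind_pmf_bayes[where \<rho> = \<rho>])
           (simp add: map_pmf_def bind_commute_pmf[of "bayes _ _ _ _"])
    qed
    note key = this
    show ?thesis
      unfolding L_def D_def data_at_def
      by (simp add: bind_assoc_pmf bind_map_pmf case_prod_unfold)
         (rule bind_pmf_cong[OF refl], use key in \<open>simp add: bind_assoc_pmf\<close>)
  qed
  have step: "N (Suc n) = D (Suc n)" if "R n = L n" for n
  proof -
    have "N (Suc n) = bind_pmf (R n) (\<lambda>(ys, us, x). map_pmf (\<lambda>x'. (ys, us, x')) (T x (last us)))"
    proof -
      have "nxt (Suc n) zs = T (st (last zs)) (last (map ac zs))"
        if "zs \<in> set_pmf (prefix_pmf T Ob p g (Suc n))" for zs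
        using length_prefix_pmf[OF that] by (cases zs rule: rev_cases) (auto simp: nxt_def)
      then show ?thesis
        unfolding N_def R_def bind_map_pmf by (auto intro!: bind_pmf_cong simp del: prefix_pmf.simps)
    qed
    also have "\<dots> = bind_pmf (L n) (\<lambda>(ys, us, x). map_pmf (\<lambda>x'. (ys, us, x')) (T x (last us)))"
      by (simp only: that)
    also have "\<dots> = D (Suc n)"
      unfolding D_def data_before_Suc_eq L_def
      by (auto simp: bind_assoc_pmf bind_map_pmf map_bind_pmf case_prod_unfold pred_Suc_append_action
          dest!: length_data_at intro!: bind_pmf_cong)
    finally show ?thesis .
  qed
  have "N n = D n" for n
  proof (induction n)
    case 0
    then show ?case by (simp add: N_def D_def nxt_def predictor_0 bind_return_pmf)
  next
    case (Suc n)
    then show ?case by (intro step) (simp only: R L)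
  qed
  then have "R n = L n" by (simp only: R L)
  then show ?thesis by (simp only: R_def L_def)
qed

end

section \<open>Discounted costs\<close>

lemma abs_le_supnorm: "\<bar>c x u\<bar> \<le> supnorm c"
  for c :: "'x::finite \<Rightarrow> 'u::finite \<Rightarrow> real"
  unfolding supnorm_def using cSUP_upper[of "(x, u)" UNIV "\<lambda>(x, u). \<bar>c x u\<bar>"] by simp

lemma supnorm_nonneg: "0 \<le> supnorm c"
  for c :: "'x::finite \<Rightarrow> 'u::finite \<Rightarrow> real"
  using abs_le_supnorm[of c undefined undefined] by linarith

lemma summable_discounted:
  fixes b :: "nat \<Rightarrow> real"
  assumes "0 \<le> \<beta>" "\<beta> < 1" "\<And>k. \<bar>b k\<bar> \<le> B"
  shows "summable (\<lambda>k. \<beta> ^ k * b k)"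
proof (rule summable_comparison_test')
  show "summable (\<lambda>k. \<beta> ^ k * B)"
    using assms by (intro summable_mult2 summable_geometric) auto
  show "norm (\<beta> ^ k * b k) \<le> \<beta> ^ k * B" for k
    using assms by (auto simp: abs_mult intro!: mult_left_mono)
qed

lemma integral_discounted:
  fixes f :: "nat \<Rightarrow> 'a \<Rightarrow> real"
  assumes "prob_space M" "0 \<le> \<beta>" "\<beta> < 1" "\<And>k. f k \<in> borel_measurable M" "\<And>k \<omega>. \<bar>f k \<omega>\<bar> \<le> B"
  shows "(\<integral>\<omega>. (\<Sum>k. \<beta> ^ k * f k \<omega>) \<partial>M) = (\<Sum>k. \<beta> ^ k * (\<integral>\<omega>. f k \<omega> \<partial>M))"
proof -
  interpret prob_space M by fact
  have f: "integrable M (f k)" for k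
    using assms by (intro integrable_const_bound[where B = B]) auto
  have "(\<integral>\<omega>. (\<Sum>k. \<beta> ^ k * f k \<omega>) \<partial>M) = (\<Sum>k. (\<integral>\<omega>. \<beta> ^ k * f k \<omega> \<partial>M))"
  proof (rule integral_suminf)
    show "AE \<omega> in M. summable (\<lambda>k. norm (\<beta> ^ k * f k \<omega>))"
      using assms summable_discounted[of \<beta> "\<lambda>k. \<bar>f k _\<bar>" B] by (auto simp: abs_mult)
    have "\<bar>\<integral>\<omega>. \<bar>f k \<omega>\<bar> \<partial>M\<bar> \<le> B" for k
    proof -
      have "(\<integral>\<omega>. \<bar>f k \<omega>\<bar> \<partial>M) \<le> (\<integral>\<omega>. B \<partial>M)"
        using f assms by (intro integral_mono) auto
      then show ?thesis by (simp add: prob_space)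
    qed
    then show "summable (\<lambda>k. \<integral>\<omega>. norm (\<beta> ^ k * f k \<omega>) \<partial>M)"
      using assms summable_discounted[of \<beta> "\<lambda>k. \<integral>\<omega>. \<bar>f k \<omega>\<bar> \<partial>M" B] by (auto simp: abs_mult)
  qed (use f in auto)
  then show ?thesis by simp
qed

text \<open>Iterating the one-step inequality n times leaves a remainder \<beta>^n a_n, which
  vanishes for bounded a, while the errors add up to a geometric series.\<close>

lemma discounted_sum_ge:
  fixes a b :: "nat \<Rightarrow> real"
  assumes \<beta>: "0 \<le> \<beta>" "\<beta> < 1"
    and step: "\<And>k. a k \<le> b k + \<beta> * a (Suc k) + e"
    and bdd: "\<And>k. \<bar>a k\<bar> \<le> A" "\<And>k. \<bar>b k\<bar> \<le> B"
  shows "a 0 \<le> (\<Sum>k. \<beta> ^ k * b k) + e / (1 - \<beta>)"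
proof -
  have part: "a 0 \<le> (\<Sum>k<n. \<beta> ^ k * b k) + e * (\<Sum>k<n. \<beta> ^ k) + \<beta> ^ n * a n" for n
  proof (induction n)
    case (Suc n)
    have "\<beta> ^ n * a n \<le> \<beta> ^ n * (b n + \<beta> * a (Suc n) + e)"
      using \<beta> step by (intro mult_left_mono) auto
    with Suc show ?case by (simp add: algebra_simps)
  qed simp
  have "(\<lambda>n. \<beta> ^ n * a n) \<longlonglongrightarrow> 0"
    by (rule summable_LIMSEQ_zero[OF summable_discounted[OF \<beta> bdd(1)]])
  moreover have "(\<lambda>n. \<Sum>k<n. \<beta> ^ k * b k) \<longlonglongrightarrow> (\<Sum>k. \<beta> ^ k * b k)"
    by (rule summable_LIMSEQ[OF summable_discounted[OF \<beta> bdd(2)]])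
  moreover have "(\<lambda>n. \<Sum>k<n. \<beta> ^ k) \<longlonglongrightarrow> 1 / (1 - \<beta>)"
    using geometric_sums[of \<beta>] \<beta> by (simp add: sums_def)
  ultimately have "(\<lambda>n. (\<Sum>k<n. \<beta> ^ k * b k) + e * (\<Sum>k<n. \<beta> ^ k) + \<beta> ^ n * a n)
      \<longlonglongrightarrow> (\<Sum>k. \<beta> ^ k * b k) + e * (1 / (1 - \<beta>)) + 0"
    by (intro tendsto_intros)
  then show ?thesis
    using part by (intro LIMSEQ_le_const) auto
qed

section \<open>Expected stage costs and restarting\<close>

context pomdp
begin

text \<open>The mean of c(X_n, U_n), as \<open>integral_traj_cost\<close> shows, but written through
  the data and the filter so that filter errors can enter.\<close>

definition stage_cost :: "('x \<Rightarrow> 'u \<Rightarrow> real) \<Rightarrow> 'x pmf \<Rightarrow> ('y, 'u) policy \<Rightarrow> nat \<Rightarrow> real" where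
  "stage_cost c p g n = measure_pmf.expectation (data_at p g n) (\<lambda>(ys, us).
     measure_pmf.expectation (g ys us) (\<lambda>u. measure_pmf.expectation (post p ys us n) (\<lambda>x. c x u)))"

lemma abs_stage_cost_le: "\<bar>stage_cost c p g n\<bar> \<le> supnorm c"
  unfolding stage_cost_def case_prod_unfold by (intro abs_expectation_le abs_le_supnorm)

lemma integral_traj_cost:
  "(\<integral>\<omega>. c (st (\<omega> n)) (ac (\<omega> n)) \<partial>traj T Ob p g) = stage_cost c p g n"
proof -
  let ?F = "\<lambda>(ys :: 'y list, us, x). c x (last us)"
  have "(\<integral>\<omega>. c (st (\<omega> n)) (ac (\<omega> n)) \<partial>traj T Ob p g)
      = (\<integral>\<omega>. (\<lambda>zs. c (st (last zs)) (ac (last zs))) (map \<omega> [0..<Suc n]) \<partial>traj T Ob p g)"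
    by simp
  also have "\<dots> = measure_pmf.expectation (prefix_pmf T Ob p g (Suc n)) (\<lambda>zs. c (st (last zs)) (ac
      (last zs)))"
    by (rule integral_traj_prefix)
  also have "\<dots> = measure_pmf.expectation (prefix_pmf T Ob p g (Suc n)) (\<lambda>zs. ?F (map ob zs, map ac
      zs, st (last zs)))"
  proof (rule expectation_cong_on)
    fix zs assume "zs \<in> set_pmf (prefix_pmf T Ob p g (Suc n))"
    then have "zs \<noteq> []" using length_prefix_pmf by fastforce
    then show "c (st (last zs)) (ac (last zs)) = ?F (map ob zs, map ac zs, st (last zs))"
      by (simp add: last_map)
  qed
  also have "\<dots> = measure_pmf.expectation (map_pmf (\<lambda>zs. (map ob zs, map ac zs, st (last zs)))
      (prefix_pmf T Ob p g (Suc n))) ?F"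
    by (rule integral_map_pmf[symmetric])
  also have "\<dots> = stage_cost c p g n"
    unfolding prefix_pmf_filter stage_cost_def
    by (subst expectation_bind_pmf[where B = "supnorm c"], auto simp: abs_le_supnorm case_prod_unfold)
       (subst expectation_bind_pmf[where B = "supnorm c"], auto simp: abs_le_supnorm case_prod_unfold)
  finally show ?thesis .
qed

lemma discounted_cost_eq:
  assumes "0 \<le> \<beta>" "\<beta> < 1"
  shows "discounted_cost T Ob c \<beta> p g = (\<Sum>n. \<beta> ^ n * stage_cost c p g n)"
proof -
  have "(\<lambda>\<omega>. c (st (\<omega> n)) (ac (\<omega> n))) \<in> borel_measurable (traj T Ob p g)" for n
  proof -
    have "(\<lambda>\<omega>. (\<lambda>zs. c (st (last zs)) (ac (last zs))) (map \<omega> [0..<Suc n])) \<in> borel_measurable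
        (traj T Ob p g)"
      by (rule measurable_compose[OF measurable_traj_prefix]) simp
    then show ?thesis by simp
  qed
  then show ?thesis
    unfolding discounted_cost_def integral_traj_cost[symmetric]
    by (intro integral_discounted[where B = "supnorm c"] prob_space_traj assms abs_le_supnorm)
qed

lemma map_prefix_pmf_data:
  "map_pmf (\<lambda>zs. (map ob zs, map ac zs)) (prefix_pmf T Ob p g n) = data_before p g n"
proof (cases n)
  case (Suc m)
  have "map_pmf (\<lambda>zs. (map ob zs, map ac zs)) (prefix_pmf T Ob p g n)
      = map_pmf (\<lambda>(ys, us, x). (ys, us)) (map_pmf (\<lambda>zs. (map ob zs, map ac zs, st (last zs)))
          (prefix_pmf T Ob p g (Suc m)))"
    unfolding Suc map_pmf_comp by simp
  also have "\<dots> = data_before p g n"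
    unfolding prefix_pmf_filter Suc data_before_Suc_eq
    by (simp add: map_bind_pmf map_pmf_comp case_prod_unfold map_pmf_const) (simp add: map_pmf_def)
  finally show ?thesis .
qed simp

lemma post_append:
  assumes "length ys = n" "length us = n"
  shows "post p (ys @ ys') (us @ us') (n + k) = post (pred p ys us n) ys' us' k"
  using assms by (simp add: posterior_eq_bayes_predictor pred_append nth_append del: posterior.simps)

text \<open>Averaging the restarted problems over the records before time \<open>n\<close> yields a
  single process under the glued policy, to which a stability estimate in mean applies.\<close>

lemma stage_cost_switch_policy:
  "measure_pmf.expectation (data_before p g n) (\<lambda>h. stage_cost c (pred p (fst h) (snd h) n) (f h) k)
    = stage_cost c p (switch_policy n g f) (n + k)"
proof -
  let ?G = "switch_policy n g f"
  let ?S = "\<lambda>h. measure_pmf.expectation (?G (fst h) (snd h)) (\<lambda>u.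
      measure_pmf.expectation (post p (fst h) (snd h) (n + k)) (\<lambda>x. c x u))"
  have S: "\<bar>?S h\<bar> \<le> supnorm c" for h
    by (intro abs_expectation_le abs_le_supnorm)
  have "stage_cost c p ?G (n + k) = measure_pmf.expectation (data_at p ?G (n + k)) ?S"
    by (simp add: stage_cost_def case_prod_unfold)
  also have "\<dots> = measure_pmf.expectation (data_before p g n) (\<lambda>h.
      measure_pmf.expectation (data_at (pred p (fst h) (snd h) n) (f h) k) (\<lambda>h'. ?S
          (fst h @ fst h', snd h @ snd h')))"
    unfolding data_at_switch_policy by (subst expectation_bind_pmf[OF S]) simp
  also have "\<dots> = measure_pmf.expectation (data_before p g n) (\<lambda>h. stage_cost c (pred p (fst h)
      (snd h) n) (f h) k)"
    unfolding stage_cost_def case_prod_unfold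
  proof (rule expectation_cong_on)
    fix h assume "h \<in> set_pmf (data_before p g n)"
    then have h: "length (fst h) = n" "length (snd h) = n" by (auto dest: length_data_before)
    show "measure_pmf.expectation (data_at (pred p (fst h) (snd h) n) (f h) k) (\<lambda>h'. ?S
        (fst h @ fst h', snd h @ snd h'))
        = measure_pmf.expectation (data_at (pred p (fst h) (snd h) n) (f h) k) (\<lambda>h'.
            measure_pmf.expectation (f h (fst h') (snd h')) (\<lambda>u.
            measure_pmf.expectation (post (pred p (fst h) (snd h) n) (fst h') (snd h') k)
                (\<lambda>x. c x u)))"
    proof (rule expectation_cong_on)
      fix h' assume "h' \<in> set_pmf (data_at (pred p (fst h) (snd h) n) (f h) k)"
      then have "length (fst h') = Suc k" "length (snd h') = k" by (auto dest: length_data_at)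
      then show "?S (fst h @ fst h', snd h @ snd h') = measure_pmf.expectation (f h (fst h')
          (snd h')) (\<lambda>u.
            measure_pmf.expectation (post (pred p (fst h) (snd h) n) (fst h') (snd h') k)
                (\<lambda>x. c x u))"
        using h by (simp add: post_append switch_policy_def)
    qed
  qed
  finally show ?thesis by simp
qed

text \<open>The mean over records is exchanged with the series; discounting starts at time
  \<open>n\<close>.\<close>

lemma discounted_cost_switch_policy:
  assumes "0 \<le> \<beta>" "\<beta> < 1"
  shows "measure_pmf.expectation (data_before p g n) (\<lambda>h.
      discounted_cost T Ob c \<beta> (pred p (fst h) (snd h) n) (f h))
    = (\<Sum>k. \<beta> ^ k * stage_cost c p (switch_policy n g f) (n + k))"
  unfolding discounted_cost_eq[OF assms] stage_cost_switch_policy[symmetric]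
  by (rule integral_discounted[where B = "supnorm c"])
     (auto simp: assms abs_stage_cost_le measure_pmf.prob_space_axioms)

section \<open>Filter stability\<close>

text \<open>The prior \<open>q\<close> is arbitrary: where a record has probability zero under \<open>q\<close>, the value \<open>\<rho>\<close>
  of the filter is as good as any other. The first observation costs no factor \<open>2 - \<delta>(O)\<close>, since
  the error before it is at most \<open>2\<close> anyway.\<close>

lemma filter_stability:
  "measure_pmf.expectation (data_at p g (s + n)) (\<lambda>(ys, us).
      l1_dist (post p ys us (s + n)) (post q (drop s ys) (drop s us) n))
    \<le> 2 * ((1 - dobrushin_tilde T) * (2 - dobrushin Ob)) ^ n"
proof (induction n)
  case 0
  show ?case
    using abs_expectation_le[of "\<lambda>h. l1_dist (post p (fst h) (snd h) s) (post q (drop s (fst h))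
        (drop s (snd h)) 0)" 2]
    by (auto simp: l1_dist_nonneg l1_dist_le_2 case_prod_unfold abs_le_iff)
next
  case (Suc n)
  let ?d = "\<lambda>n h. l1_dist (post p (fst h) (snd h) (s + n)) (post q (drop s (fst h)) (drop s
      (snd h)) n)"
  let ?a = "(1 - dobrushin_tilde T) * (2 - dobrushin Ob)"
  have d: "\<bar>?d n h\<bar> \<le> 2" for n h by (simp add: l1_dist_nonneg l1_dist_le_2)
  have a: "0 \<le> ?a"
    using dobrushin_tilde_le_1[of T] dobrushin_le_1[of Ob] by simp
  let ?next = "\<lambda>h u. bind_pmf (bind_pmf (post p (fst h) (snd h) (s + n)) (\<lambda>x. T x u)) Ob"
  have "measure_pmf.expectation (data_at p g (s + Suc n)) (?d (Suc n))
      = measure_pmf.expectation (data_at p g (s + n)) (\<lambda>h. measure_pmf.expectation (g (fst h)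
          (snd h)) (\<lambda>u.
          measure_pmf.expectation (?next h u) (\<lambda>y. ?d (Suc n) (fst h @ [y], snd h @ [u]))))"
    unfolding add_Suc_right data_at_Suc case_prod_unfold
    by (subst expectation_bind_pmf[OF d[where n = "Suc n", unfolded add_Suc_right]],
        subst expectation_bind_pmf[OF d[where n = "Suc n", unfolded add_Suc_right]]) simp
  also have "\<dots> \<le> measure_pmf.expectation (data_at p g (s + n)) (\<lambda>h. ?a * ?d n h)"
  proof (rule expectation_mono_on[where B = 2 and C = "?a * 2"])
    fix h assume "h \<in> set_pmf (data_at p g (s + n))"
    then have h: "length (fst h) = Suc (s + n)" "length (snd h) = s + n"
      by (auto dest: length_data_at)
    let ?p = "post p (fst h) (snd h) (s + n)" and ?q = "post q (drop s (fst h)) (drop s (snd h)) n"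
    have "measure_pmf.expectation (?next h u) (\<lambda>y. ?d (Suc n) (fst h @ [y], snd h @ [u]))
        \<le> ?a * ?d n h" for u
    proof -
      \<comment> \<open>Both filters process the same action and observation. The observation is
        drawn from the prediction of the true filter, the averaging law in
        \<open>expectation_l1_dist_bayes_le\<close>.\<close>
      have "post p (fst h @ [y]) (snd h @ [u]) (s + Suc n) = bayes \<rho> Ob (bind_pmf ?p (\<lambda>x. T x u)) y"
        "post q (drop s (fst h @ [y])) (drop s (snd h @ [u])) (Suc n)
            = bayes \<rho> Ob (bind_pmf ?q (\<lambda>x. T x u)) y" for y
        using h by (simp_all add: post_append_observation pred_Suc_append_action del: posterior.simps)
      then have "measure_pmf.expectation (?next h u) (\<lambda>y. ?d (Suc n) (fst h @ [y], snd h @ [u]))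
          \<le> (2 - dobrushin Ob) * l1_dist (bind_pmf ?p (\<lambda>x. T x u)) (bind_pmf ?q (\<lambda>x. T x u))"
        using expectation_l1_dist_bayes_le by (simp del: posterior.simps)
      also have "\<dots> \<le> (2 - dobrushin Ob) * ((1 - dobrushin_tilde T) * l1_dist ?p ?q)"
      proof (rule mult_left_mono)
        have "l1_dist (bind_pmf ?p (\<lambda>x. T x u)) (bind_pmf ?q (\<lambda>x. T x u))
            \<le> (1 - dobrushin (\<lambda>x. T x u)) * l1_dist ?p ?q"
          by (rule l1_dist_bind_le)
        also have "\<dots> \<le> (1 - dobrushin_tilde T) * l1_dist ?p ?q"
          using dobrushin_tilde_le[of T u] by (intro mult_right_mono) (auto simp: l1_dist_nonneg)
        finally show "l1_dist (bind_pmf ?p (\<lambda>x. T x u)) (bind_pmf ?q (\<lambda>x. T x u))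
            \<le> (1 - dobrushin_tilde T) * l1_dist ?p ?q" .
      qed (use dobrushin_le_1[of Ob] in simp)
      finally show ?thesis by (simp add: mult_ac)
    qed
    then show "measure_pmf.expectation (g (fst h) (snd h)) (\<lambda>u.
          measure_pmf.expectation (?next h u) (\<lambda>y. ?d (Suc n) (fst h @ [y], snd h @ [u])))
              \<le> ?a * ?d n h"
      by (rule expectation_le_const[where C = 2]) (intro abs_expectation_le d)
  next
    show "\<bar>?a * ?d n h\<bar> \<le> ?a * 2" for h
      unfolding abs_mult[of ?a] abs_of_nonneg[OF a] by (rule mult_left_mono[OF d a])
  qed (intro abs_expectation_le d)
  also have "\<dots> = ?a * measure_pmf.expectation (data_at p g (s + n)) (?d n)"
    by simp
  also have "\<dots> \<le> ?a * (2 * ?a ^ n)"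
    using a Suc.IH by (intro mult_left_mono) (simp_all add: case_prod_unfold)
  finally show ?case by (simp add: case_prod_unfold mult_ac)
qed

end

section \<open>Window values along the true process\<close>

lemma finite_windows: "finite (windows N :: ('y::finite, 'u::finite) window set)"
proof -
  have "windows N = {ys :: 'y list. length ys = N + 1} \<times> {us :: 'u list. length us = N}"
    by (auto simp: windows_def)
  then show ?thesis
    using finite_lists_length_eq[of "UNIV :: 'y set"] finite_lists_length_eq[of "UNIV :: 'u set"]
        by simp
qed

text \<open>The oldest entry leaves as the new one enters; for \<open>n = 0\<close> the new entry
  itself is dropped.\<close>

lemma suffix_of_append_singleton:
  "n \<le> length xs \<Longrightarrow> suffix_of n (xs @ [x]) = tl (suffix_of n xs @ [x])"
proof -
  assume "n \<le> length xs"
  then have "suffix_of n (xs @ [x]) = drop (Suc (length xs - n)) (xs @ [x])"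
    by (simp add: suffix_of_def Suc_diff_le)
  also have "\<dots> = tl (drop (length xs - n) (xs @ [x]))"
    by (simp only: drop_Suc tl_drop)
  finally show ?thesis by (simp add: suffix_of_def)
qed

definition recent :: "nat \<Rightarrow> 'y list \<times> 'u list \<Rightarrow> ('y, 'u) window" where
  "recent N h = (suffix_of (N + 1) (fst h), suffix_of N (snd h))"

lemma recent_in_windows: "N < length ys \<Longrightarrow> N \<le> length us \<Longrightarrow> recent N (ys, us) \<in> windows N"
  by (auto simp: recent_def windows_def suffix_of_def)

lemma recent_append:
  "N < length ys \<Longrightarrow> N \<le> length us
    \<Longrightarrow> recent N (ys @ [y], us @ [u]) = shift_window (recent N (ys, us)) u y"
  by (simp add: recent_def suffix_of_append_singleton)

text \<open>The fixed-point equation constrains \<open>Q\<close> on \<open>windows N\<close> only.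
  The value 0 elsewhere makes the function globally bounded and turns the sum over windows into an
  expectation.\<close>

definition window_value :: "nat \<Rightarrow> (('y, 'u::finite) window \<Rightarrow> 'u \<Rightarrow> real) \<Rightarrow> ('y, 'u) window \<Rightarrow> real"
    where
  "window_value N Q I = (if I \<in> windows N then Min (range (Q I)) else 0)"

section \<open>The limiting fixed point\<close>

locale window_fixpoint = pomdp T Ob \<rho>
  for T :: "'x::finite \<Rightarrow> 'u::finite \<Rightarrow> 'x pmf" and Ob :: "'x \<Rightarrow> 'y::finite pmf" and \<rho> :: "'x pmf" +
  fixes c :: "'x \<Rightarrow> 'u \<Rightarrow> real" and \<beta> :: real and N :: nat and q :: "'x pmf"
    and Q :: "('y, 'u) window \<Rightarrow> 'u \<Rightarrow> real"
  assumes \<beta>: "0 < \<beta>" "\<beta> < 1"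
    and fixpoint: "solves_Qstar \<rho> T Ob c \<beta> N q Q"
begin

text \<open>Bound on any discounted cost, used as a uniform bound for \<open>V\<close> and
  \<open>lookahead\<close>.\<close>

definition K :: real where "K = supnorm c / (1 - \<beta>)"

abbreviation V :: "('y, 'u) window \<Rightarrow> real" where "V \<equiv> window_value N Q"

lemma K_nonneg: "0 \<le> K"
  using \<beta> supnorm_nonneg[of c] by (simp add: K_def)

lemma Q_bellman:
  assumes "I \<in> windows N"
  shows "Q I u = Cstar \<rho> T Ob c N q I u + \<beta> * measure_pmf.expectation (Pstar \<rho> T Ob N q I u) V"
proof -
  have "measure_pmf.expectation (Pstar \<rho> T Ob N q I u) V
      = (\<Sum>I'\<in>windows N. V I' * pmf (Pstar \<rho> T Ob N q I u) I')"
    by (rule integral_measure_pmf_real) (auto simp: finite_windows window_value_def split: if_splits)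
  then show ?thesis
    using fixpoint assms by (simp add: solves_Qstar_def window_value_def mult.commute)
qed

lemma abs_Cstar_le: "\<bar>Cstar \<rho> T Ob c N q I u\<bar> \<le> supnorm c"
  unfolding Cstar_def case_prod_unfold by (intro abs_expectation_le abs_le_supnorm)

lemma V_le: "I \<in> windows N \<Longrightarrow> V I \<le> Q I u"
  by (simp add: window_value_def)

lemma V_attained: "I \<in> windows N \<Longrightarrow> \<exists>u. V I = Q I u"
  using Min_in[of "range (Q I)", unfolded image_iff] by (simp add: window_value_def)

text \<open>The maximum M of |V| satisfies M \<le> \<parallel>c\<parallel> + \<beta> M by the
  Bellman equation at a minimizing action.\<close>

lemma abs_V_le: "\<bar>V I\<bar> \<le> K"
proof -
  \<comment> \<open>Inserting 0 covers the value off \<open>windows N\<close> and keeps the set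
    nonempty.\<close>
  define M where "M = Max (insert 0 ((\<lambda>I. \<bar>V I\<bar>) ` windows N))"
  have fin: "finite (insert 0 ((\<lambda>I. \<bar>V I\<bar>) ` windows N))"
    by (simp add: finite_windows)
  have V_M: "\<bar>V I\<bar> \<le> M" for I
  proof (cases "I \<in> windows N")
    case True
    then show ?thesis unfolding M_def by (intro Max_ge[OF fin]) auto
  next
    case False
    moreover have "0 \<le> M" unfolding M_def by (intro Max_ge[OF fin]) auto
    ultimately show ?thesis by (simp add: window_value_def)
  qed
  have "\<bar>V I\<bar> \<le> supnorm c + \<beta> * M" if "I \<in> windows N" for I
  proof -
    obtain u where "V I = Q I u" using V_attained[OF \<open>I \<in> windows N\<close>] by blast
    moreover have "\<bar>\<beta> * measure_pmf.expectation (Pstar \<rho> T Ob N q I u) V\<bar> \<le> \<beta> * M"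
      using abs_expectation_le[of V M, OF V_M] \<beta> by (simp add: abs_mult)
    ultimately show ?thesis
      using Q_bellman[OF that, of u] abs_Cstar_le[of I u] by linarith
  qed
  moreover have "0 \<le> supnorm c + \<beta> * M"
    using V_M[of undefined] \<beta> supnorm_nonneg[of c] by simp
  moreover have "M \<in> insert 0 ((\<lambda>I. \<bar>V I\<bar>) ` windows N)"
    unfolding M_def using fin by (rule Max_in) simp
  ultimately have "M \<le> supnorm c + \<beta> * M" by auto
  then have "M \<le> K" using \<beta> by (simp add: K_def field_simps)
  with V_M show ?thesis by (rule order_trans)
qed

text \<open>Right-hand side of the Bellman equation for a known state. Its mean under the window
  filter is \<open>Q\<close>, and its mean under the true filter is what the process really incurs,
  so the two differ only through the filter.\<close>

definition lookahead :: "('y, 'u) window \<Rightarrow> 'u \<Rightarrow> 'x \<Rightarrow> real" where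
  "lookahead I u x = c x u + \<beta> * measure_pmf.expectation (bind_pmf (T x u) Ob) (\<lambda>y. V
      (shift_window I u y))"

lemma abs_lookahead_le: "\<bar>lookahead I u x\<bar> \<le> K"
proof -
  have "\<bar>\<beta> * measure_pmf.expectation (bind_pmf (T x u) Ob) (\<lambda>y. V (shift_window I u y))\<bar> \<le> \<beta> * K"
    unfolding abs_mult using \<beta> by (intro mult_mono abs_expectation_le abs_V_le) auto
  then have "\<bar>lookahead I u x\<bar> \<le> supnorm c + \<beta> * K"
    using abs_le_supnorm[of c x u] unfolding lookahead_def by linarith
  also have "\<dots> = K" using \<beta> by (simp add: K_def field_simps)
  finally show ?thesis .
qed

lemma expectation_lookahead:
  "measure_pmf.expectation r (lookahead I u) = measure_pmf.expectation r (\<lambda>x. c x u)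
    + \<beta> * measure_pmf.expectation (bind_pmf (bind_pmf r (\<lambda>x. T x u)) Ob) (\<lambda>y. V (shift_window I u y))"
proof -
  have "bind_pmf (bind_pmf r (\<lambda>x. T x u)) Ob = bind_pmf r (\<lambda>x. bind_pmf (T x u) Ob)"
    by (simp add: bind_assoc_pmf)
  then show ?thesis
    unfolding lookahead_def
    by (subst Bochner_Integration.integral_add)
       (simp_all add: integrable_measure_pmf_finite expectation_bind_pmf[OF abs_V_le, of
           "bind_pmf _ _"]
         expectation_bind_pmf[where f = "\<lambda>y. V (shift_window I u y)", OF abs_V_le])
qed

lemma Q_eq_lookahead:
  assumes "(ys, us) \<in> windows N"
  shows "Q (ys, us) u = measure_pmf.expectation (post q ys us N) (lookahead (ys, us) u)"
proof -
  have "length us = N" using assms by (simp add: windows_def)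
  then have "next_obs \<rho> T Ob q ((!) ys) ((!) (us @ [u])) N = bind_pmf (bind_pmf (post q ys us N)
      (\<lambda>x. T x u)) Ob"
    by (simp add: next_obs_def pred_Suc_append_action)
  then show ?thesis
    unfolding Q_bellman[OF assms] expectation_lookahead
    by (simp add: Cstar_def Pstar_def)
qed

section \<open>Effect of the filter error\<close>

definition filter_error :: "'x pmf \<Rightarrow> nat \<Rightarrow> 'y list \<times> 'u list \<Rightarrow> real" where
  "filter_error p n h = l1_dist (post p (fst h) (snd h) n) (post q (fst (recent N h)) (snd
      (recent N h)) N)"

text \<open>\<open>lookahead\<close> is bounded by \<open>K\<close>, and its means under the two
  filters differ by at most \<open>K\<close> times their distance.\<close>

lemma Q_error:
  assumes "N < length (fst h)" "N \<le> length (snd h)"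
  shows "\<bar>Q (recent N h) u - measure_pmf.expectation (post p (fst h) (snd h) n) (lookahead
      (recent N h) u)\<bar>
    \<le> K * filter_error p n h"
proof -
  have "recent N h \<in> windows N"
    using recent_in_windows[of N "fst h" "snd h"] assms by simp
  then have "Q (recent N h) u
      = measure_pmf.expectation (post q (fst (recent N h)) (snd (recent N h)) N) (lookahead
          (recent N h) u)"
    using Q_eq_lookahead[of "fst (recent N h)" "snd (recent N h)" u] by simp
  then show ?thesis
    unfolding filter_error_def
    using expectation_diff_le_l1_dist[OF abs_lookahead_le] by (simp add: abs_minus_commute)
qed

definition mean_value :: "'x pmf \<Rightarrow> ('y, 'u) policy \<Rightarrow> nat \<Rightarrow> real" where
  "mean_value p g n = measure_pmf.expectation (data_at p g n) (\<lambda>h. V (recent N h))"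

definition mean_error :: "'x pmf \<Rightarrow> ('y, 'u) policy \<Rightarrow> nat \<Rightarrow> real" where
  "mean_error p g n = measure_pmf.expectation (data_at p g n) (filter_error p n)"

lemma mean_error_le:
  assumes "N \<le> n"
  shows "mean_error p g n \<le> 2 * ((1 - dobrushin_tilde T) * (2 - dobrushin Ob)) ^ N"
proof -
  \<comment> \<open>The window at time \<open>n\<close> starts at time \<open>s = n - N\<close>;
    everything before is forgotten.\<close>
  obtain s where n: "n = s + N" using assms by (metis add.commute le_Suc_ex)
  have "mean_error p g n = measure_pmf.expectation (data_at p g (s + N)) (\<lambda>(ys, us).
      l1_dist (post p ys us (s + N)) (post q (drop s ys) (drop s us) N))"
    unfolding mean_error_def n
    by (rule expectation_cong_on)
       (auto simp: filter_error_def recent_def suffix_of_def dest!: length_data_at)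
  then show ?thesis using filter_stability by simp
qed

lemma filter_error_bounds: "0 \<le> filter_error p n h" "filter_error p n h \<le> 2"
  by (simp_all add: filter_error_def l1_dist_nonneg l1_dist_le_2)

lemma abs_filter_error_le: "\<bar>filter_error p n h\<bar> \<le> 2"
  using filter_error_bounds[of p n h] by simp

lemma abs_K_filter_error_le: "\<bar>K * filter_error p n h\<bar> \<le> K * 2"
  unfolding abs_mult using K_nonneg by (intro mult_mono abs_filter_error_le) auto

lemma abs_mean_value_le: "\<bar>mean_value p g n\<bar> \<le> K"
  unfolding mean_value_def by (intro abs_expectation_le abs_V_le)

section \<open>Approximate Bellman inequalities\<close>

definition mean_lookahead :: "'x pmf \<Rightarrow> ('y, 'u) policy \<Rightarrow> nat \<Rightarrow> 'y list \<times> 'u list \<Rightarrow> real" where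
  "mean_lookahead p g n h = measure_pmf.expectation (g (fst h) (snd h)) (\<lambda>u.
     measure_pmf.expectation (post p (fst h) (snd h) n) (lookahead (recent N h) u))"

lemma abs_mean_lookahead_le: "\<bar>mean_lookahead p g n h\<bar> \<le> K"
  unfolding mean_lookahead_def by (intro abs_expectation_le abs_lookahead_le)

text \<open>Tower property: \<open>mean_lookahead\<close> is the conditional mean, given the record,
  of the stage cost plus the discounted value of the next window. From time \<open>N\<close> on that
  window is a shift of the current one.\<close>

lemma expectation_mean_lookahead:
  assumes "N \<le> n"
  shows "measure_pmf.expectation (data_at p g n) (mean_lookahead p g n)
    = stage_cost c p g n + \<beta> * mean_value p g (Suc n)"
proof -
  let ?next = "\<lambda>h u. bind_pmf (bind_pmf (post p (fst h) (snd h) n) (\<lambda>x. T x u)) Ob"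
  let ?b = "\<lambda>h u. measure_pmf.expectation (post p (fst h) (snd h) n) (\<lambda>x. c x u)"
  let ?v = "\<lambda>h u. measure_pmf.expectation (?next h u) (\<lambda>y. V (shift_window (recent N h) u y))"
  let ?E = "\<lambda>F. measure_pmf.expectation (data_at p g n) (\<lambda>h. measure_pmf.expectation (g (fst h)
      (snd h)) (F h))"
  have b: "\<bar>?b h u\<bar> \<le> supnorm c" and v: "\<bar>?v h u\<bar> \<le> K" for h u
    by (intro abs_expectation_le abs_le_supnorm abs_V_le)+
  have next_value: "mean_value p g (Suc n) = ?E ?v"
  proof -
    have "mean_value p g (Suc n) = ?E (\<lambda>h u. measure_pmf.expectation (?next h u) (\<lambda>y. V (recent N
        (fst h @ [y], snd h @ [u]))))"
      unfolding mean_value_def data_at_Suc case_prod_unfold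
      by (subst expectation_bind_pmf[OF abs_V_le], subst expectation_bind_pmf[OF abs_V_le]) simp
    also have "\<dots> = ?E ?v"
    proof (rule expectation_cong_on)
      fix h assume "h \<in> set_pmf (data_at p g n)"
      then have "N < length (fst h)" "N \<le> length (snd h)"
        using assms by (auto dest!: length_data_at)
      then show "measure_pmf.expectation (g (fst h) (snd h)) (\<lambda>u. measure_pmf.expectation
          (?next h u) (\<lambda>y. V (recent N (fst h @ [y], snd h @ [u]))))
          = measure_pmf.expectation (g (fst h) (snd h)) (?v h)"
        by (simp add: recent_append)
    qed
    finally show ?thesis .
  qed
  have "measure_pmf.expectation (data_at p g n) (mean_lookahead p g n)
      = ?E (\<lambda>h u. ?b h u + \<beta> * ?v h u)"
    unfolding mean_lookahead_def expectation_lookahead ..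
  also have "\<dots> = measure_pmf.expectation (data_at p g n) (\<lambda>h. measure_pmf.expectation (g (fst h)
      (snd h)) (?b h)
      + \<beta> * measure_pmf.expectation (g (fst h) (snd h)) (?v h))"
    by (subst Bochner_Integration.integral_add) (simp_all add: integrable_measure_pmf_finite)
  also have "\<dots> = ?E ?b + \<beta> * ?E ?v"
  proof (subst Bochner_Integration.integral_add)
    show "integrable (data_at p g n) (\<lambda>h. measure_pmf.expectation (g (fst h) (snd h)) (?b h))"
      by (intro integrable_pmf_bounded[where B = "supnorm c"] abs_expectation_le b)
    have "integrable (data_at p g n) (\<lambda>h. measure_pmf.expectation (g (fst h) (snd h)) (?v h))"
      by (intro integrable_pmf_bounded[where B = K] abs_expectation_le v)
    then show "integrable (data_at p g n) (\<lambda>h. \<beta> * measure_pmf.expectation (g (fst h) (snd h))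
        (?v h))"
      by simp
  qed simp
  finally show ?thesis
    by (simp add: next_value stage_cost_def case_prod_unfold)
qed

text \<open>V(I) is at most Q(I, u) for whatever action the policy draws; passing from the window
  filter to the true one costs \<open>K\<close> times the filter error.\<close>

lemma mean_value_le:
  assumes "N \<le> n"
  shows "mean_value p g n \<le> stage_cost c p g n + \<beta> * mean_value p g (Suc n) + K * mean_error p g n"
proof -
  have "mean_value p g n \<le> measure_pmf.expectation (data_at p g n) (\<lambda>h. mean_lookahead p g n h
      + K * filter_error p n h)"
    unfolding mean_value_def
  proof (rule expectation_mono_on)
    fix h assume "h \<in> set_pmf (data_at p g n)"
    then have h: "N < length (fst h)" "N \<le> length (snd h)"
      using assms by (auto dest!: length_data_at)
    then have win: "recent N h \<in> windows N"
      using recent_in_windows[of N "fst h" "snd h"] by simp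
    let ?L = "\<lambda>u. measure_pmf.expectation (post p (fst h) (snd h) n) (lookahead (recent N h) u)"
    have "V (recent N h) - K * filter_error p n h \<le> ?L u" for u
      using V_le[OF win, of u] Q_error[OF h, of u p n] by linarith
    then have "measure_pmf.expectation (g (fst h) (snd h)) (\<lambda>_. V (recent N h) - K * filter_error
        p n h)
        \<le> measure_pmf.expectation (g (fst h) (snd h)) ?L"
      by (rule expectation_mono_on[where C = K, OF _ order_refl]) (intro abs_expectation_le
          abs_lookahead_le)
    then show "V (recent N h) \<le> mean_lookahead p g n h + K * filter_error p n h"
      by (simp add: mean_lookahead_def)
  next
    show "\<bar>mean_lookahead p g n h + K * filter_error p n h\<bar> \<le> K + K * 2" for h
      using abs_mean_lookahead_le[of p g n h] abs_K_filter_error_le[of p n h] by linarith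
  qed (rule abs_V_le)
  also have "\<dots> = measure_pmf.expectation (data_at p g n) (mean_lookahead p g n) + K * mean_error p
      g n"
    unfolding mean_error_def
    by (subst Bochner_Integration.integral_add)
       (simp_all add: integrable_pmf_bounded[OF abs_mean_lookahead_le] integrable_pmf_bounded[OF
           abs_filter_error_le])
  finally show ?thesis by (simp only: expectation_mean_lookahead[OF assms])
qed

text \<open>At a greedy action V(I) = Q(I, u), so the bound of \<open>Q_error\<close> can be used in
  the opposite direction.\<close>

lemma mean_value_ge:
  assumes "N \<le> n"
    and greedy: "\<And>I. I \<in> windows N \<Longrightarrow> Q I (\<gamma> I) = Min (range (Q I))"
    and g: "\<And>ys us. length ys = Suc n \<Longrightarrow> length us = n \<Longrightarrow> g ys us = return_pmf (\<gamma> (recent N (ys, us)))"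
  shows "stage_cost c p g n + \<beta> * mean_value p g (Suc n) - K * mean_error p g n \<le> mean_value p g n"
proof -
  have "measure_pmf.expectation (data_at p g n) (\<lambda>h. mean_lookahead p g n h - K * filter_error p n
      h) \<le> mean_value p g n"
    unfolding mean_value_def
  proof (rule expectation_mono_on)
    fix h assume "h \<in> set_pmf (data_at p g n)"
    then have len: "length (fst h) = Suc n" "length (snd h) = n"
      by (auto dest!: length_data_at)
    then have h: "N < length (fst h)" "N \<le> length (snd h)" using assms by auto
    then have win: "recent N h \<in> windows N"
      using recent_in_windows[of N "fst h" "snd h"] by simp
    have "Q (recent N h) (\<gamma> (recent N h)) = V (recent N h)"
      using greedy[OF win] win by (simp add: window_value_def)
    then show "mean_lookahead p g n h - K * filter_error p n h \<le> V (recent N h)"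
      using Q_error[OF h, of "\<gamma> (recent N h)" p n] g[OF len]
          by (simp add: mean_lookahead_def abs_le_iff)
  next
    show "\<bar>mean_lookahead p g n h - K * filter_error p n h\<bar> \<le> K + K * 2" for h
      using abs_mean_lookahead_le[of p g n h] abs_K_filter_error_le[of p n h] by linarith
  qed (rule abs_V_le)
  moreover have "measure_pmf.expectation (data_at p g n) (\<lambda>h. mean_lookahead p g n h
      - K * filter_error p n h)
      = measure_pmf.expectation (data_at p g n) (mean_lookahead p g n) - K * mean_error p g n"
    unfolding mean_error_def
    by (subst Bochner_Integration.integral_diff)
       (simp_all add: integrable_pmf_bounded[OF abs_mean_lookahead_le] integrable_pmf_bounded[OF
           abs_filter_error_le])
  ultimately show ?thesis by (simp only: expectation_mean_lookahead[OF assms(1)])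
qed

section \<open>Telescoping from time N on\<close>

abbreviation error_bound :: real where
  "error_bound \<equiv> K * (2 * ((1 - dobrushin_tilde T) * (2 - dobrushin Ob)) ^ N)"

lemma K_mean_error_le: "N \<le> n \<Longrightarrow> K * mean_error p g n \<le> error_bound"
  by (rule mult_left_mono[OF mean_error_le K_nonneg])

lemma cost_ge_value:
  "mean_value p g N \<le> (\<Sum>k. \<beta> ^ k * stage_cost c p g (N + k)) + error_bound / (1 - \<beta>)"
proof -
  have "mean_value p g (N + k) \<le> stage_cost c p g (N + k) + \<beta> * mean_value p g (N + Suc k)
      + error_bound" for k
    using mean_value_le[of "N + k" p g] K_mean_error_le[of "N + k" p g] by simp
  from discounted_sum_ge[of \<beta> "\<lambda>k. mean_value p g (N + k)", OF _ _ this abs_mean_value_le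
      abs_stage_cost_le]
  show ?thesis using \<beta> by simp
qed

lemma cost_le_value:
  assumes greedy: "\<And>I. I \<in> windows N \<Longrightarrow> Q I (\<gamma> I) = Min (range (Q I))"
    and g: "\<And>ys us. N < length ys \<Longrightarrow> length ys = Suc (length us) \<Longrightarrow> g ys us
        = return_pmf (\<gamma> (recent N (ys, us)))"
  shows "(\<Sum>k. \<beta> ^ k * stage_cost c p g (N + k)) \<le> mean_value p g N + error_bound / (1 - \<beta>)"
proof -
  \<comment> \<open>Negating values and costs brings the reverse inequality into the form of
    \<open>discounted_sum_ge\<close>.\<close>
  have "- mean_value p g (N + k) \<le> - stage_cost c p g (N + k) + \<beta> * - mean_value p g (N + Suc k)
      + error_bound" for k
    using mean_value_ge[of "N + k" \<gamma> g p] K_mean_error_le[of "N + k" p g] greedy g by simp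
  from discounted_sum_ge[of \<beta> "\<lambda>k. - mean_value p g (N + k)" "\<lambda>k. - stage_cost c p g (N
      + k)", OF _ _ this, of K "supnorm c"]
  have "- mean_value p g N \<le> (\<Sum>k. \<beta> ^ k * - stage_cost c p g (N + k)) + error_bound / (1 - \<beta>)"
    using \<beta> abs_mean_value_le abs_stage_cost_le by simp
  also have "(\<Sum>k. \<beta> ^ k * - stage_cost c p g (N + k)) = - (\<Sum>k. \<beta> ^ k * stage_cost c p g (N + k))"
    using summable_discounted[of \<beta> "\<lambda>k. stage_cost c p g (N + k)" "supnorm c"] \<beta> abs_stage_cost_le
    by (simp add: suminf_minus)
  finally show ?thesis by simp
qed

section \<open>Comparison with a competitor and the mean regret\<close>

lemma data_at_switch_policy_self: "data_at p (switch_policy N g f) N = data_at p g N"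
  by (simp add: data_at_def data_before_switch_policy_le)

text \<open>The action at time \<open>N\<close> comes after the observation at \<open>N\<close>, so
  the window at \<open>N\<close> has the same law for both glued policies, and the mean of
  \<open>V\<close> there cancels between the upper and the lower bound.\<close>

lemma switch_cost_difference:
  assumes greedy: "\<And>I. I \<in> windows N \<Longrightarrow> Q I (\<gamma> I) = Min (range (Q I))"
  shows "measure_pmf.expectation (data_before p g N) (\<lambda>h.
        discounted_cost T Ob c \<beta> (pred p (fst h) (snd h) N) (window_policy N \<gamma> (fst h) (snd h)))
      \<le> measure_pmf.expectation (data_before p g N) (\<lambda>h.
        discounted_cost T Ob c \<beta> (pred p (fst h) (snd h) N) (f h))
      + 4 * supnorm c / (1 - \<beta>)\<^sup>2 * ((1 - dobrushin_tilde T) * (2 - dobrushin Ob)) ^ N"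
proof -
  let ?w = "\<lambda>h. window_policy N \<gamma> (fst h) (snd h)"
  have *: "switch_policy N g ?w ys us = return_pmf (\<gamma> (recent N (ys, us)))"
    if "N < length ys" "length ys = Suc (length us)" for ys us
    using that by (simp add: switch_policy_def window_policy_def recent_def)
  have "mean_value p (switch_policy N g h) N = mean_value p g N" for h
    by (simp add: mean_value_def data_at_switch_policy_self)
  then have "(\<Sum>k. \<beta> ^ k * stage_cost c p (switch_policy N g ?w) (N + k))
      \<le> (\<Sum>k. \<beta> ^ k * stage_cost c p (switch_policy N g f) (N + k)) + 2 * (error_bound / (1 - \<beta>))"
    using cost_le_value[of \<gamma> "switch_policy N g ?w" p, OF greedy *] cost_ge_value[of p
        "switch_policy N g f"]
    by simp
  \<comment> \<open>The 4 is two comparisons times the maximal distance 2; one factor 1 / (1 -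
    \<beta>) comes from \<open>K\<close>, the other from telescoping.\<close>
  also have "2 * (error_bound / (1 - \<beta>))
      = 4 * supnorm c / (1 - \<beta>)\<^sup>2 * ((1 - dobrushin_tilde T) * (2 - dobrushin Ob)) ^ N"
    by (simp add: K_def power2_eq_square)
  finally show ?thesis
    using \<beta> by (simp only: discounted_cost_switch_policy)
qed

text \<open>The window at time \<open>N\<close> is the whole record, and neither the predictor nor
  the restarted window policy reads its last observation; the mean is thus over the data before
  \<open>N\<close>.\<close>

lemma expected_regret_eq:
  "expected_regret \<rho> T Ob c \<beta> N \<gamma> p g = measure_pmf.expectation (data_before p g N) (\<lambda>h.
      discounted_cost T Ob c \<beta> (pred p (fst h) (snd h) N) (window_policy N \<gamma> (fst h) (snd h))
      - optimal_cost T Ob c \<beta> (pred p (fst h) (snd h) N))"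
proof -
  let ?R = "\<lambda>h. discounted_cost T Ob c \<beta> (pred p (fst h) (snd h) N) (window_policy N \<gamma> (fst h)
      (snd h))
      - optimal_cost T Ob c \<beta> (pred p (fst h) (snd h) N)"
  have "regret \<rho> T Ob c \<beta> N \<gamma> p (info N \<omega> N)
      = (\<lambda>zs. ?R (map ob zs, map ac zs)) (map \<omega> [0..<N])" for \<omega> :: "nat \<Rightarrow> 'x \<times> 'y \<times> 'u"
  proof -
    let ?ys = "map (\<lambda>k. ob (\<omega> k)) [0..<N]" and ?us = "map (\<lambda>k. ac (\<omega> k)) [0..<N]"
    have "pred p (?ys @ [ob (\<omega> N)]) ?us N = pred p ?ys ?us N"
      by (rule predictor_cong) (simp_all add: nth_append)
    then show ?thesis by (simp add: regret_def info_def Let_def comp_def)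
  qed
  then have "expected_regret \<rho> T Ob c \<beta> N \<gamma> p g
      = measure_pmf.expectation (prefix_pmf T Ob p g N) (\<lambda>zs. ?R (map ob zs, map ac zs))"
    unfolding expected_regret_def
    by (subst integral_traj_prefix[symmetric]) (simp only:)
  also have "\<dots> = measure_pmf.expectation (map_pmf (\<lambda>zs. (map ob zs, map ac zs)) (prefix_pmf T Ob p
      g N)) ?R"
    by (rule integral_map_pmf[symmetric])
  finally show ?thesis by (simp only: map_prefix_pmf_data)
qed

text \<open>Makes every function of the record integrable, in particular the infimum
  \<open>optimal_cost\<close>.\<close>

lemma finite_set_data_before: "finite (set_pmf (data_before p g n))"
  by (induction n) auto

text \<open>For every record an \<epsilon>-optimal policy of the restarted problem is chosen;
  together these choices form one competitor that depends on the record, and \<epsilon> is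
  arbitrary.\<close>

lemma expected_regret_le:
  assumes greedy: "\<And>I. I \<in> windows N \<Longrightarrow> Q I (\<gamma> I) = Min (range (Q I))"
  shows "expected_regret \<rho> T Ob c \<beta> N \<gamma> p g
    \<le> 4 * supnorm c / (1 - \<beta>)\<^sup>2 * ((1 - dobrushin_tilde T) * (2 - dobrushin Ob)) ^ N"
proof (rule field_le_epsilon)
  fix \<epsilon> :: real assume "0 < \<epsilon>"
  let ?r = "\<lambda>h. pred p (fst h) (snd h) N"
  let ?E = "measure_pmf.expectation (data_before p g N)"
  have "\<exists>f. discounted_cost T Ob c \<beta> (?r h) (\<lambda>ys us. return_pmf (f ys us))
      < optimal_cost T Ob c \<beta> (?r h) + \<epsilon>" for h
  proof -
    have "optimal_cost T Ob c \<beta> (?r h) < optimal_cost T Ob c \<beta> (?r h) + \<epsilon>"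
      using \<open>0 < \<epsilon>\<close> by simp
    from cInf_lessD[OF _ this[unfolded optimal_cost_def[of T Ob c \<beta> "?r h", THEN eq_reflection]]]
    show ?thesis by (auto simp: optimal_cost_def)
  qed
  then obtain f where f: "discounted_cost T Ob c \<beta> (?r h) (\<lambda>ys us. return_pmf (f h ys us))
      < optimal_cost T Ob c \<beta> (?r h) + \<epsilon>" for h
    by metis
  let ?w = "\<lambda>h. discounted_cost T Ob c \<beta> (?r h) (window_policy N \<gamma> (fst h) (snd h))"
  let ?f = "\<lambda>h. discounted_cost T Ob c \<beta> (?r h) (\<lambda>ys us. return_pmf (f h ys us))"
  have int: "integrable (data_before p g N) F" for F :: "_ \<Rightarrow> real"
    by (rule integrable_measure_pmf_finite[OF finite_set_data_before])
  have "?w h - optimal_cost T Ob c \<beta> (?r h) \<le> ?w h - ?f h + \<epsilon>" for h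
    using f[of h] by simp
  then have "expected_regret \<rho> T Ob c \<beta> N \<gamma> p g \<le> ?E (\<lambda>h. ?w h - ?f h + \<epsilon>)"
    unfolding expected_regret_eq by (intro integral_mono int)
  also have "\<dots> = ?E ?w - ?E ?f + \<epsilon>"
    by (simp add: int)
  finally show "expected_regret \<rho> T Ob c \<beta> N \<gamma> p g
      \<le> 4 * supnorm c / (1 - \<beta>)\<^sup>2 * ((1 - dobrushin_tilde T) * (2 - dobrushin Ob)) ^ N + \<epsilon>"
    using switch_cost_difference[OF greedy, of p g "\<lambda>h ys us. return_pmf (f h ys us)"] by simp
qed

end

theorem corollary5p6:
  fixes T :: "'x::finite \<Rightarrow> 'u::finite \<Rightarrow> 'x pmf"
    and Ob :: "'x \<Rightarrow> 'y::finite pmf"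
    and c :: "'x \<Rightarrow> 'u \<Rightarrow> real"
    and \<beta> :: real
    and N :: nat
    and \<rho> :: "'x pmf"
    and \<sigma> :: "'u pmf"
    and \<mu>\<^sub>0 :: "'x pmf"
    and \<alpha> :: "nat \<Rightarrow> (nat \<Rightarrow> 'x \<times> 'y \<times> 'u) \<Rightarrow> ('y, 'u) window \<Rightarrow> 'u \<Rightarrow> real"
    and Q :: "nat \<Rightarrow> (nat \<Rightarrow> 'x \<times> 'y \<times> 'u) \<Rightarrow> ('y, 'u) window \<Rightarrow> 'u \<Rightarrow> real"
    and Q\<^sub>0 :: "('y, 'u) window \<Rightarrow> 'u \<Rightarrow> real"
    and \<pi>star :: "'x pmf"
    and Qstar :: "('y, 'u) window \<Rightarrow> 'u \<Rightarrow> real"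
    and \<gamma>N :: "('y, 'u) window \<Rightarrow> 'u"
    and \<mu> :: "'x pmf"
    and g :: "('y, 'u) policy"
  assumes beta: "0 < \<beta>" "\<beta> < 1"
    and exploration: "\<And>u. pmf \<sigma> u > 0"
    and rates: "\<And>t \<omega> I u. I \<in> windows N \<Longrightarrow> \<alpha> t \<omega> I u =
          (if N \<le> t \<and> info N \<omega> t = I \<and> ac (\<omega> t) = u
           then 1 / (1 + (\<Sum>k=N..t. of_bool (info N \<omega> k = I \<and> ac (\<omega> k) = u))) else 0)"
    and Q_init: "\<And>\<omega> I u. I \<in> windows N \<Longrightarrow> Q 0 \<omega> I u = Q\<^sub>0 I u"
    and Q_step: "\<And>t \<omega> I u. I \<in> windows N \<Longrightarrow> Q (Suc t) \<omega> I u =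
          (1 - \<alpha> t \<omega> I u) * Q t \<omega> I u
          + \<alpha> t \<omega> I u * (c (st (\<omega> t)) (ac (\<omega> t)) + \<beta> * Min (range (Q t \<omega> (info N \<omega> (Suc t)))))"
    and Harris: "\<And>m h. exploring h \<Longrightarrow> positive_Harris T Ob m h"
    and visits: "AE \<omega> in traj T Ob \<mu>\<^sub>0 (\<lambda>_ _. \<sigma>). \<forall>I\<in>windows N. \<forall>u.
          \<exists>\<^sub>\<infinity>t. N \<le> t \<and> info N \<omega> t = I \<and> ac (\<omega> t) = u"
    and irreducible: "irreducible_kernel (iid_kernel T \<sigma>)"
    and contraction: "(1 - dobrushin_tilde T) * (2 - dobrushin Ob) < 1"
    and invariant: "bind_pmf \<pi>star (iid_kernel T \<sigma>) = \<pi>star"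
    and Qstar: "solves_Qstar \<rho> T Ob c \<beta> N \<pi>star Qstar"
    and greedy: "\<And>I. I \<in> windows N \<Longrightarrow> Qstar I (\<gamma>N I) = Min (range (Qstar I))"
  shows "expected_regret \<rho> T Ob c \<beta> N \<gamma>N \<mu> g
           \<le> 4 * supnorm c / (1 - \<beta>)\<^sup>2 * ((1 - dobrushin_tilde T) * (2 - dobrushin Ob)) ^ N"
proof -
  interpret window_fixpoint T Ob \<rho> c \<beta> N \<pi>star Qstar
    by unfold_locales (fact beta Qstar)+
  show ?thesis
    by (rule expected_regret_le[OF greedy])
qed

end
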